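(* The class of projectively flat and dually flat spherically symmetric Finsler metrics constitutes a solution for the $H$-unicorn Landsberg problem; that is, the spherically symmetric Finsler metrics that are both projectively flat and dually flat are $H$-Landsberg metrics but are not $H$-Berwaldian.
   Context: Let $M$ be an $n$-dimensional smooth manifold with tangent bundle $TM$ and slit tangent bundle $\mathcal{T}M=TM\setminus\{0\}$, $(x^i)$ local coordinates on $M$, $(x^i,y^i)$ the induced coordinates on $TM$, $\partial_i:=\frac{\partial}{\partial x^i}$, $\dot{\partial}_i:=\frac{\partial}{\partial y^i}$; the summation convention is used. A Finsler metric on $M$ is a function $F:TM\to\mathbb{R}$ with $F\ge 0$, $F(x,y)=0$ iff $y=0$, $F$ smooth on $\mathcal{T}M$, $F(x,\lambda y)=\lambda F(x,y)$ for $\lambda>0$, and $g_{ij}:=\frac12\dot{\partial}_i\dot{\partial}_jF^2$ non-degenerate on $\mathcal{T}M$; $(g^{ij})$ is the inverse matrix. A spherically symmetric Finsler metric on the ball $\mathbb{B}^n(r_0)\subset\mathbb{R}^n$ is one of the form $F(x,y)=|y|\,\varphi\left(|x|,\frac{\langle x,y\rangle}{|y|}\right)$, where $\varphi:[0,r_0)\times\mathbb{R}\to\mathbb{R}$ is a smooth function, $(x,y)\in T\mathbb{B}^n(r_0)\setminus\{0\}$, and $|\cdot|$, $\langle\cdot,\cdot\rangle$ are the standard Euclidean norm and inner product on $\mathbb{R}^n$. The geodesic spray coefficients of $F$ are $G^i=\frac14 g^{ih}(y^r\partial_r\dot{\partial}_hF^2-\partial_hF^2)$, and the $F$-covariant coefficients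 are $H_i:=g_{ir}G^r=\frac14(y^r\partial_r\dot{\partial}_iF^2-\partial_iF^2)$. $F$ is projectively flat if and only if $y^k\dot{\partial}_i\partial_kF-\partial_iF=0$. $F$ is locally dually flat if at each point there is a local coordinate system $(x^i)$, called adapted, in which $y^k\dot{\partial}_i\partial_kF^2-2\partial_iF^2=0$; it is dually flat if it is locally dually flat and, in any adapted local system, $G^i=-\frac12g^{ij}\dot{\partial}_jK$, where $K=K(x,y)$ is a smooth function on $\mathcal{T}M$, positively $3$-homogeneous in $y$. By a result of Najafi, a spherically symmetric metric $F=|y|\,\varphi(r,s)$, with $r=|x|$ and $s=\langle x,y\rangle/|y|$, is both projectively flat and dually flat if and only if $\varphi(r,s)=\frac{\sqrt{(k^2-c^2r^2)+c^2s^2}+cs}{k^2-c^2r^2}$, where $k$ and $c$ are constants. Let $H_{ijkh}:=\dot{\partial}_h\dot{\partial}_k\dot{\partial}_jH_i$ and $\mathcal{L}_{jkh}:=y^iH_{ijkh}$. $F$ is $H$-Berwald ($H$-Berwaldian) if $H_{ijkh}$ vanishes, that is, if the $H_i$ are quadratic in $y$; $F$ is $H$-Landsberg ($H$-Landsbergian) if $\mathcal{L}_{jkh}$ vanishes. The $H$-unicorn Landsberg problem is the problem of finding $H$-Landsberg metrics that are not $H$-Berwaldian.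
   Formalization: Dual flatness is also required in the standard coordinates of the ball; "not H-Berwaldian" is claimed only for n ≥ 2 and metrics other than constant multiples of the Euclidean norm |y| (c = 0), since the claim fails in those excluded cases. *)

theory Defs
  imports "HOL-Analysis.Analysis"
begin

text \<open>
  The base manifold is an open subset \<open>U\<close> of Euclidean n-space, so \<open>TU\<close> is \<open>U \<times> UNIV\<close> and
  functions on it are functions of pairs \<open>(x, y)\<close> (only their values over \<open>U\<close> matter).
\<close>

primrec dir_derivs :: "'a list \<Rightarrow> ('a::real_normed_vector \<Rightarrow> 'b::real_normed_vector) \<Rightarrow> 'a \<Rightarrow> 'b" where
  "dir_derivs [] f = f"
| "dir_derivs (v # vs) f = (\<lambda>x. frechet_derivative (dir_derivs vs f) (at x) v)"

text \<open>
  \<open>smooth_on\<close> is meant for open \<open>S\<close>: all iterated directional derivatives are (Frechet)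
  differentiable, hence continuous, at all points of \<open>S\<close>, i.e. \<open>f\<close> is infinitely differentiable.
\<close>

definition smooth_on :: "'a::real_normed_vector set \<Rightarrow> ('a \<Rightarrow> 'b::real_normed_vector) \<Rightarrow> bool" where
  "smooth_on S f \<longleftrightarrow> (\<forall>vs. \<forall>x\<in>S. dir_derivs vs f differentiable (at x))"

type_synonym 'n tangent = "(real ^ 'n) \<times> (real ^ 'n)"

definition slit :: "(real ^ 'n) set \<Rightarrow> ('n::finite) tangent set" where
  "slit U = U \<times> (UNIV - {0})"

definition dx :: "'n \<Rightarrow> (('n::finite) tangent \<Rightarrow> real) \<Rightarrow> 'n tangent \<Rightarrow> real" where
  "dx i f p = frechet_derivative f (at p) (axis i 1, 0)"

definition dy :: "'n \<Rightarrow> (('n::finite) tangent \<Rightarrow> real) \<Rightarrow> 'n tangent \<Rightarrow> real" where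
  "dy i f p = frechet_derivative f (at p) (0, axis i 1)"

abbreviation sq :: "(('n::finite) tangent \<Rightarrow> real) \<Rightarrow> 'n tangent \<Rightarrow> real" where
  "sq F \<equiv> (\<lambda>p. (F p)\<^sup>2)"

definition fund_tensor :: "(('n::finite) tangent \<Rightarrow> real) \<Rightarrow> 'n tangent \<Rightarrow> real ^ 'n ^ 'n" where
  "fund_tensor F p = (\<chi> i j. 1/2 * dy i (dy j (sq F)) p)"

definition finsler_metric :: "(real ^ 'n) set \<Rightarrow> (('n::finite) tangent \<Rightarrow> real) \<Rightarrow> bool" where
  "finsler_metric U F \<longleftrightarrow>
     (\<forall>x\<in>U. \<forall>y. 0 \<le> F (x, y) \<and> (F (x, y) = 0 \<longleftrightarrow> y = 0)) \<and>
     smooth_on (slit U) F \<and>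
     (\<forall>x\<in>U. \<forall>y. \<forall>l>0. F (x, l *\<^sub>R y) = l * F (x, y)) \<and>
     (\<forall>p\<in>slit U. invertible (fund_tensor F p))"

text \<open>
  Smoothness of \<open>\<phi>\<close> on the non-open set \<open>[0, r0) \<times> \<real>\<close> means being the restriction of a smooth
  function on an open neighbourhood \<open>W\<close>; the bound \<open>\<phi>\<close> below is that extension.
\<close>

definition spherically_symmetric :: "real \<Rightarrow> (('n::finite) tangent \<Rightarrow> real) \<Rightarrow> bool" where
  "spherically_symmetric r0 F \<longleftrightarrow>
     (\<exists>(\<phi> :: real \<times> real \<Rightarrow> real) W.
        open W \<and> {0..<r0} \<times> UNIV \<subseteq> W \<and> smooth_on W \<phi> \<and>
        (\<forall>x\<in>ball 0 r0. \<forall>y. y \<noteq> 0 \<longrightarrow> F (x, y) = norm y * \<phi> (norm x, (x \<bullet> y) / norm y)))"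

definition spray :: "(('n::finite) tangent \<Rightarrow> real) \<Rightarrow> 'n \<Rightarrow> 'n tangent \<Rightarrow> real" where
  "spray F i p = 1/4 * (\<Sum>h\<in>UNIV. matrix_inv (fund_tensor F p) $ i $ h *
      ((\<Sum>r\<in>UNIV. snd p $ r * dx r (dy h (sq F)) p) - dx h (sq F) p))"

definition covariant_coeff :: "(('n::finite) tangent \<Rightarrow> real) \<Rightarrow> 'n \<Rightarrow> 'n tangent \<Rightarrow> real" where
  "covariant_coeff F i p = (\<Sum>r\<in>UNIV. fund_tensor F p $ i $ r * spray F r p)"

definition projectively_flat :: "(real ^ 'n) set \<Rightarrow> (('n::finite) tangent \<Rightarrow> real) \<Rightarrow> bool" where
  "projectively_flat U F \<longleftrightarrow>
     (\<forall>p\<in>slit U. \<forall>i. (\<Sum>k\<in>UNIV. snd p $ k * dy i (dx k F) p) - dx i F p = 0)"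

definition dual_flat_eqs :: "(real ^ 'n) set \<Rightarrow> (('n::finite) tangent \<Rightarrow> real) \<Rightarrow> bool" where
  "dual_flat_eqs U F \<longleftrightarrow>
     (\<forall>p\<in>slit U. \<forall>i. (\<Sum>k\<in>UNIV. snd p $ k * dy i (dx k (sq F)) p) - 2 * dx i (sq F) p = 0)"

text \<open>
  A local coordinate system of \<open>U\<close> is given by its parametrization \<open>\<psi>\<close>, a diffeomorphism from the
  coordinate domain \<open>V\<close> onto an open part of \<open>U\<close>; \<open>in_coords \<psi> F\<close> is the expression of \<open>F\<close> in
  the coordinates induced on the tangent bundle.
\<close>

definition local_coords ::
    "(real ^ 'n) set \<Rightarrow> (real ^ 'n) set \<Rightarrow> (real ^ 'n \<Rightarrow> real ^ ('n::finite)) \<Rightarrow> bool" where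
  "local_coords U V \<psi> \<longleftrightarrow>
     open V \<and> open (\<psi> ` V) \<and> \<psi> ` V \<subseteq> U \<and> inj_on \<psi> V \<and>
     smooth_on V \<psi> \<and> smooth_on (\<psi> ` V) (the_inv_into V \<psi>)"

definition in_coords ::
    "(real ^ 'n \<Rightarrow> real ^ 'n) \<Rightarrow> (('n::finite) tangent \<Rightarrow> real) \<Rightarrow> 'n tangent \<Rightarrow> real" where
  "in_coords \<psi> F = (\<lambda>(x, y). F (\<psi> x, frechet_derivative \<psi> (at x) y))"

definition adapted ::
    "(real ^ 'n) set \<Rightarrow> (('n::finite) tangent \<Rightarrow> real) \<Rightarrow> (real ^ 'n) set \<Rightarrow> (real ^ 'n \<Rightarrow> real ^ 'n) \<Rightarrow> bool" where
  "adapted U F V \<psi> \<longleftrightarrow> local_coords U V \<psi> \<and> dual_flat_eqs V (in_coords \<psi> F)"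

definition locally_dually_flat :: "(real ^ 'n) set \<Rightarrow> (('n::finite) tangent \<Rightarrow> real) \<Rightarrow> bool" where
  "locally_dually_flat U F \<longleftrightarrow> (\<forall>x\<in>U. \<exists>V \<psi>. adapted U F V \<psi> \<and> x \<in> \<psi> ` V)"

definition dually_flat :: "(real ^ 'n) set \<Rightarrow> (('n::finite) tangent \<Rightarrow> real) \<Rightarrow> bool" where
  "dually_flat U F \<longleftrightarrow>
     locally_dually_flat U F \<and>
     (\<forall>V \<psi>. adapted U F V \<psi> \<longrightarrow>
        (\<exists>K. smooth_on (slit V) K \<and>
             (\<forall>(x, y)\<in>slit V. \<forall>l>0. K (x, l *\<^sub>R y) = l ^ 3 * K (x, y)) \<and>
             (\<forall>p\<in>slit V. \<forall>i. spray (in_coords \<psi> F) i p =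
                - 1/2 * (\<Sum>j\<in>UNIV. matrix_inv (fund_tensor (in_coords \<psi> F) p) $ i $ j * dy j K p))))"

text \<open>
  Projective flatness and dual flatness refer to the same (standard) coordinates of the ball, so
  these are required to be adapted. This is essential for Najafi's classification of such
  metrics: the Klein metric of the unit ball is projectively flat in the standard coordinates and
  has local adapted coordinates, but the standard ones are not adapted to it, and it is not in
  Najafi's family.
\<close>

definition flat_spherical_metric :: "real \<Rightarrow> (('n::finite) tangent \<Rightarrow> real) \<Rightarrow> bool" where
  "flat_spherical_metric r0 F \<longleftrightarrow>
     finsler_metric (ball 0 r0) F \<and> spherically_symmetric r0 F \<and>
     projectively_flat (ball 0 r0) F \<and>
     dually_flat (ball 0 r0) F \<and> adapted (ball 0 r0) F (ball 0 r0) (\<lambda>x. x)"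

text \<open>The members of Najafi's family with \<open>c = 0\<close>.\<close>

definition scaled_euclidean :: "real \<Rightarrow> (('n::finite) tangent \<Rightarrow> real) \<Rightarrow> bool" where
  "scaled_euclidean r0 F \<longleftrightarrow> (\<exists>a. \<forall>x\<in>ball 0 r0. \<forall>y. F (x, y) = a * norm y)"

definition H4 :: "(('n::finite) tangent \<Rightarrow> real) \<Rightarrow> 'n \<Rightarrow> 'n \<Rightarrow> 'n \<Rightarrow> 'n \<Rightarrow> 'n tangent \<Rightarrow> real" where
  "H4 F i j k h = dy h (dy k (dy j (covariant_coeff F i)))"

definition H_Berwald :: "(real ^ 'n) set \<Rightarrow> (('n::finite) tangent \<Rightarrow> real) \<Rightarrow> bool" where
  "H_Berwald U F \<longleftrightarrow> (\<forall>p\<in>slit U. \<forall>i j k h. H4 F i j k h p = 0)"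

definition H_Landsberg :: "(real ^ 'n) set \<Rightarrow> (('n::finite) tangent \<Rightarrow> real) \<Rightarrow> bool" where
  "H_Landsberg U F \<longleftrightarrow>
     (\<forall>p\<in>slit U. \<forall>j k h. (\<Sum>i\<in>UNIV. snd p $ i * H4 F i j k h p) = 0)"

definition H_unicorn :: "(real ^ 'n) set \<Rightarrow> (('n::finite) tangent \<Rightarrow> real) \<Rightarrow> bool" where
  "H_unicorn U F \<longleftrightarrow> H_Landsberg U F \<and> \<not> H_Berwald U F"

end

theory Submission
  imports Defs
begin

text \<open>
  Write \<open>F\<^sub>0 = y\<^sup>k \<partial>\<^sub>k F\<close> and let \<open>P = y\<^sup>k \<partial>\<^sub>k F\<^sup>2 / 12\<close>, a function of degree three in \<open>y\<close>.
  The dual flatness equation identifies the covariant spray coefficients \<open>H\<^sub>i\<close> with the vertical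
  gradient of \<open>P\<close> (\<open>covariant_coeff_dual_flat\<close>). So \<open>H\<^sub>i\<^sub>j\<^sub>k\<^sub>h\<close> consists of the fourth vertical
  derivatives of \<open>P\<close>, and contracting it with \<open>y\<^sup>i\<close> is Euler's identity for the third derivatives,
  which have degree zero. This is the Landsberg property (\<open>dual_flat_imp_H_Landsberg\<close>).

  If projective flatness holds as well, then \<open>F\<^sub>0 = c(x) F\<^sup>2\<close> on every fibre
  (\<open>flat_drift_proportional\<close>), whence \<open>P = c(x) F\<^sup>3 / 6\<close>. For a Berwald metric the fourth derivatives
  of \<open>P\<close> vanish, so \<open>P\<close> is a cubic polynomial in \<open>y\<close>, in particular an odd function
  (\<open>odd_if_fourth_derivatives_vanish\<close>). But \<open>F\<^sup>3\<close> is positive, so \<open>c = 0\<close>; then \<open>F\<close> does not depend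
  on \<open>x\<close> and spherical symmetry makes it a multiple of the Euclidean norm
  (\<open>flat_spherical_H_Berwald_imp_scaled_euclidean\<close>). Dimension at least two enters through
  the connectedness of the punctured fibre.

  An example is the Funk metric of the ball. It satisfies \<open>\<partial>\<^sub>k F = F \<partial>F/\<partial>y\<^sup>k\<close> (\<open>funk_dx_eq\<close>), and both
  flatness equations follow from this relation by Euler's identity. Its fundamental tensor is
  positive definite by the Cauchy-Schwarz inequality (\<open>funk_fund_tensor_invertible\<close>). The function
  \<open>K\<close> that dual flatness asks for in every adapted coordinate system is \<open>-2 P\<close>, formed in those
  coordinates (\<open>adapted_ident_imp_dually_flat\<close>).

  Horizontal and vertical derivatives are reordered by the symmetry of second derivatives
  (\<open>dir_deriv_commute\<close>). In the Landsberg contraction and in the flatness equations of the Funk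
  metric this is what brings Euler's identity into play.
\<close>

section \<open>Calculus of smooth functions\<close>

abbreviation dir_deriv :: "'a \<Rightarrow> ('a::real_normed_vector \<Rightarrow> 'b::real_normed_vector) \<Rightarrow> 'a \<Rightarrow> 'b" where
  "dir_deriv v f \<equiv> (\<lambda>x. frechet_derivative f (at x) v)"

text \<open>
  Every closure property of smoothness is an induction on the order of differentiation, since the
  derivative of a product or a composite contains the factors themselves as well as their derivatives.
  The order is counted by peeling the innermost derivative off the iterated directional derivatives:
  then the induction hypothesis applies to \<open>dir_deriv v f\<close> as a function of its own.
\<close>

primrec diff_order :: "nat \<Rightarrow> 'a::real_normed_vector set \<Rightarrow> ('a \<Rightarrow> 'b::real_normed_vector) \<Rightarrow> bool" where
  "diff_order 0 S f \<longleftrightarrow> (\<forall>x\<in>S. f differentiable at x)"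
| "diff_order (Suc k) S f \<longleftrightarrow> (\<forall>x\<in>S. f differentiable at x) \<and> (\<forall>v. diff_order k S (dir_deriv v f))"

lemma dir_derivs_snoc: "dir_derivs (vs @ [v]) f = dir_derivs vs (dir_deriv v f)"
  by (induction vs) simp_all

lemma diff_order_iff:
  "diff_order k S f \<longleftrightarrow> (\<forall>vs. length vs \<le> k \<longrightarrow> (\<forall>x\<in>S. dir_derivs vs f differentiable at x))"
proof (induction k arbitrary: f)
  case 0
  then show ?case by simp
next
  case (Suc k)
  show ?case
  proof
    assume *: "diff_order (Suc k) S f"
    show "\<forall>vs. length vs \<le> Suc k \<longrightarrow> (\<forall>x\<in>S. dir_derivs vs f differentiable at x)"
    proof (intro allI impI ballI)
      fix vs :: "'a list" and x
      assume "length vs \<le> Suc k" "x \<in> S"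
      then show "dir_derivs vs f differentiable at x"
      proof (cases vs rule: rev_cases)
        case Nil
        then show ?thesis using * \<open>x \<in> S\<close> by simp
      next
        case (snoc ws v)
        have "diff_order k S (dir_deriv v f)"
          using * by simp
        then have "dir_derivs ws (dir_deriv v f) differentiable at x"
          unfolding Suc.IH using \<open>length vs \<le> Suc k\<close> \<open>x \<in> S\<close> snoc by simp
        then show ?thesis
          by (simp only: snoc dir_derivs_snoc)
      qed
    qed
  next
    assume *: "\<forall>vs. length vs \<le> Suc k \<longrightarrow> (\<forall>x\<in>S. dir_derivs vs f differentiable at x)"
    have "diff_order k S (dir_deriv v f)" for v
      unfolding Suc.IH
    proof (intro allI impI ballI)
      fix vs :: "'a list" and x
      assume "length vs \<le> k" "x \<in> S"
      then show "dir_derivs vs (dir_deriv v f) differentiable at x"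
        using *[rule_format, of "vs @ [v]" x] by (simp add: dir_derivs_snoc)
    qed
    then show "diff_order (Suc k) S f"
      using *[rule_format, of "[]"] by simp
  qed
qed

lemma smooth_on_iff_diff_order: "smooth_on S f \<longleftrightarrow> (\<forall>k. diff_order k S f)"
proof
  show "\<forall>k. diff_order k S f" if "smooth_on S f"
    using that unfolding smooth_on_def diff_order_iff by simp
  show "smooth_on S f" if *: "\<forall>k. diff_order k S f"
    unfolding smooth_on_def
  proof
    fix vs :: "'a list"
    show "\<forall>x\<in>S. dir_derivs vs f differentiable at x"
      using *[rule_format, of "length vs"] unfolding diff_order_iff by blast
  qed
qed

lemma smooth_on_differentiable: "smooth_on S f \<Longrightarrow> x \<in> S \<Longrightarrow> f differentiable at x"
  unfolding smooth_on_iff_diff_order by (drule spec[of _ 0]) simp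

lemma smooth_on_dir_deriv: "smooth_on S f \<Longrightarrow> smooth_on S (dir_deriv v f)"
  unfolding smooth_on_iff_diff_order
proof
  show "diff_order k S (dir_deriv v f)" if "\<forall>k. diff_order k S f" for k
    using that[rule_format, of "Suc k"] by simp
qed

lemma dir_deriv_cong:
  assumes "open S" "x \<in> S" "\<And>y. y \<in> S \<Longrightarrow> f y = g y"
  shows "frechet_derivative f (at x) = frechet_derivative g (at x)"
proof -
  have "(f has_derivative D) (at x) \<longleftrightarrow> (g has_derivative D) (at x)" for D
  proof
    show "(g has_derivative D) (at x)" if "(f has_derivative D) (at x)"
      using that assms by (rule has_derivative_transform_within_open)
    show "(f has_derivative D) (at x)" if "(g has_derivative D) (at x)"
      using that assms(1,2) by (rule has_derivative_transform_within_open) (rule assms(3)[symmetric])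
  qed
  then show ?thesis
    by (simp add: frechet_derivative_def)
qed

lemma differentiable_cong_open:
  assumes "open S" "x \<in> S" "\<And>y. y \<in> S \<Longrightarrow> f y = g y" "f differentiable at x"
  shows "g differentiable at x"
  using has_derivative_transform_within_open[of f _ x UNIV S g] assms unfolding differentiable_def by blast

lemma diff_order_cong:
  assumes "open S" "\<And>x. x \<in> S \<Longrightarrow> f x = g x" "diff_order k S f"
  shows "diff_order k S g"
  using assms(2,3)
proof (induction k arbitrary: f g)
  case 0
  then show ?case using differentiable_cong_open[OF assms(1)] by (metis diff_order.simps(1))
next
  case (Suc k)
  have "diff_order k S (dir_deriv v g)" for v
  proof (rule Suc.IH)
    show "dir_deriv v f x = dir_deriv v g x" if "x \<in> S" for x
      using dir_deriv_cong[OF assms(1) that Suc.prems(1)] by simp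
    show "diff_order k S (dir_deriv v f)"
      using Suc.prems(2) by simp
  qed
  then show ?case using Suc.prems differentiable_cong_open[OF assms(1)] by (metis diff_order.simps(2))
qed

lemma smooth_on_cong:
  assumes "open S" "\<And>x. x \<in> S \<Longrightarrow> f x = g x" "smooth_on S f"
  shows "smooth_on S g"
  using assms diff_order_cong unfolding smooth_on_iff_diff_order by metis

lemma diff_order_Suc_imp: "diff_order (Suc k) S f \<Longrightarrow> diff_order k S f"
  unfolding diff_order_iff by auto

lemma diff_order_const: "diff_order k S (\<lambda>x. c)"
proof (induction k arbitrary: c)
  case (Suc k)
  then show ?case by simp
qed simp

lemma dir_deriv_eq: "(f has_derivative D) (at x) \<Longrightarrow> frechet_derivative f (at x) v = D v"
  using frechet_derivative_at by metis

lemma differentiable_has_dir_deriv: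
  "f differentiable at x \<Longrightarrow> (f has_derivative (\<lambda>v. frechet_derivative f (at x) v)) (at x)"
  by (simp add: frechet_derivative_works)

lemma diff_order_bounded_linear:
  assumes "bounded_linear L" "open S"
  shows "diff_order k S f \<Longrightarrow> diff_order k S (\<lambda>x. L (f x))"
proof (induction k arbitrary: f)
  case 0
  then show ?case
    using bounded_linear.has_derivative[OF assms(1)] unfolding diff_order.simps differentiable_def by blast
next
  case (Suc k)
  have d: "((\<lambda>x. L (f x)) has_derivative (\<lambda>v. L (frechet_derivative f (at x) v))) (at x)" if "x \<in> S" for x
    using that Suc.prems by (auto intro!: bounded_linear.has_derivative[OF assms(1)] differentiable_has_dir_deriv)
  have "diff_order k S (dir_deriv v (\<lambda>x. L (f x)))" for v
    by (rule diff_order_cong[OF assms(2) _ Suc.IH[of "dir_deriv v f"]])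
       (use Suc.prems dir_deriv_eq[OF d] in auto)
  then show ?case using d unfolding diff_order.simps differentiable_def by blast
qed

lemma diff_order_add:
  assumes "open S"
  shows "diff_order k S f \<Longrightarrow> diff_order k S g \<Longrightarrow> diff_order k S (\<lambda>x. f x + g x)"
proof (induction k arbitrary: f g)
  case 0
  then show ?case by auto
next
  case (Suc k)
  have d: "((\<lambda>x. f x + g x) has_derivative
      (\<lambda>v. frechet_derivative f (at x) v + frechet_derivative g (at x) v)) (at x)" if "x \<in> S" for x
    using that Suc.prems by (auto intro!: has_derivative_add differentiable_has_dir_deriv)
  have "diff_order k S (dir_deriv v (\<lambda>x. f x + g x))" for v
    by (rule diff_order_cong[OF assms _ Suc.IH[of "dir_deriv v f" "dir_deriv v g"]])
       (use Suc.prems dir_deriv_eq[OF d] in auto)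
  then show ?case using d unfolding diff_order.simps differentiable_def by blast
qed

lemma diff_order_sum:
  assumes "open S" "\<And>i. i \<in> I \<Longrightarrow> diff_order k S (f i)"
  shows "diff_order k S (\<lambda>x. \<Sum>i\<in>I. f i x)"
  using assms(2) by (induction I rule: infinite_finite_induct)
    (auto intro: diff_order_const diff_order_add[OF assms(1)])

lemma diff_order_bilinear:
  assumes "bounded_bilinear h" "open S"
  shows "diff_order k S f \<Longrightarrow> diff_order k S g \<Longrightarrow> diff_order k S (\<lambda>x. h (f x) (g x))"
proof (induction k arbitrary: f g)
  case 0
  then show ?case
    using bounded_bilinear.FDERIV[OF assms(1)] unfolding diff_order.simps differentiable_def by blast
next
  case (Suc k)
  have d: "((\<lambda>x. h (f x) (g x)) has_derivative
      (\<lambda>v. h (f x) (frechet_derivative g (at x) v) + h (frechet_derivative f (at x) v) (g x))) (at x)"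
    if "x \<in> S" for x
    using that Suc.prems
    by (auto intro!: bounded_bilinear.FDERIV[OF assms(1)] differentiable_has_dir_deriv)
  have lower: "diff_order k S f" "diff_order k S g"
    using Suc.prems by (blast intro: diff_order_Suc_imp)+
  have "diff_order k S (dir_deriv v (\<lambda>x. h (f x) (g x)))" for v
    by (rule diff_order_cong[OF assms(2) _ diff_order_add[OF assms(2)
            Suc.IH[of f "dir_deriv v g"] Suc.IH[of "dir_deriv v f" g]]])
       (use Suc.prems dir_deriv_eq[OF d] lower in auto)
  then show ?case using d unfolding diff_order.simps differentiable_def by blast
qed

text \<open>
  The directional derivative of \<open>f \<circ> g\<close> is the derivative of \<open>f\<close> at \<open>g x\<close> in the
  direction \<open>\<partial>g/\<partial>v\<close>, a direction that moves with \<open>x\<close>. Expanding it in a basis separates the two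
  dependences on \<open>x\<close>: what remains is a finite sum of products of components of \<open>\<partial>g/\<partial>v\<close> with
  composites of lower order. This is why the intermediate space is Euclidean.
\<close>

lemma diff_order_compose:
  fixes g :: "'a::real_normed_vector \<Rightarrow> 'b::euclidean_space" and f :: "'b \<Rightarrow> 'c::real_normed_vector"
  assumes "open S" "open T" "g ` S \<subseteq> T"
  shows "diff_order k T f \<Longrightarrow> diff_order k S g \<Longrightarrow> diff_order k S (\<lambda>x. f (g x))"
proof (induction k arbitrary: f)
  case 0
  then show ?case using assms(3) by (force intro!: differentiable_compose[of f g])
next
  case (Suc k)
  have fg: "f differentiable at (g x)" "g differentiable at x" if "x \<in> S" for x
    using that Suc.prems assms(3) by auto
  have d: "((\<lambda>x. f (g x)) has_derivative
      (\<lambda>v. frechet_derivative f (at (g x)) (frechet_derivative g (at x) v))) (at x)"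
    if "x \<in> S" for x
    using diff_chain_at[OF fg(2)[OF that, THEN differentiable_has_dir_deriv] fg(1)[OF that, THEN differentiable_has_dir_deriv]]
    by (simp add: o_def)
  have e: "frechet_derivative f (at (g x)) w = (\<Sum>b\<in>Basis. (w \<bullet> b) *\<^sub>R dir_deriv b f (g x))"
    if "x \<in> S" for x w
  proof -
    interpret linear "frechet_derivative f (at (g x))"
      using fg(1)[OF that] by (rule linear_frechet_derivative)
    show ?thesis
      by (subst euclidean_representation[of w, symmetric]) (simp add: sum scale)
  qed
  have "diff_order k S (dir_deriv v (\<lambda>x. f (g x)))" for v
  proof (rule diff_order_cong[OF assms(1)])
    show "(\<Sum>b\<in>Basis. (dir_deriv v g x \<bullet> b) *\<^sub>R dir_deriv b f (g x)) = dir_deriv v (\<lambda>x. f (g x)) x"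
      if "x \<in> S" for x
      unfolding dir_deriv_eq[OF d[OF that]] by (rule e[OF that, symmetric])
    have "diff_order k S (dir_deriv v g)"
      using Suc.prems by simp
    then show "diff_order k S (\<lambda>x. \<Sum>b\<in>Basis. (dir_deriv v g x \<bullet> b) *\<^sub>R dir_deriv b f (g x))"
      using Suc.prems diff_order_Suc_imp[OF Suc.prems(2)]
      by (auto intro!: diff_order_sum diff_order_bilinear[OF bounded_bilinear_scaleR] assms Suc.IH
          diff_order_bounded_linear[OF bounded_linear_inner_left])
  qed
  then show ?case using d unfolding diff_order.simps differentiable_def by blast
qed

lemma smooth_on_const: "smooth_on S (\<lambda>x. c)"
  by (simp add: smooth_on_iff_diff_order diff_order_const)

lemma smooth_on_ident: "smooth_on S (\<lambda>x. x)"
  unfolding smooth_on_iff_diff_order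
proof
  show "diff_order k S (\<lambda>x. x)" for k
    by (cases k) (auto simp: diff_order_const)
qed

lemma smooth_on_bounded_linear:
  "bounded_linear L \<Longrightarrow> open S \<Longrightarrow> smooth_on S f \<Longrightarrow> smooth_on S (\<lambda>x. L (f x))"
  by (simp add: smooth_on_iff_diff_order diff_order_bounded_linear)

lemma smooth_on_add:
  "open S \<Longrightarrow> smooth_on S f \<Longrightarrow> smooth_on S g \<Longrightarrow> smooth_on S (\<lambda>x. f x + g x)"
  by (simp add: smooth_on_iff_diff_order diff_order_add)

lemma smooth_on_sum:
  "open S \<Longrightarrow> (\<And>i. i \<in> I \<Longrightarrow> smooth_on S (f i)) \<Longrightarrow> smooth_on S (\<lambda>x. \<Sum>i\<in>I. f i x)"
  by (simp add: smooth_on_iff_diff_order diff_order_sum)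

lemma smooth_on_bilinear:
  "bounded_bilinear h \<Longrightarrow> open S \<Longrightarrow> smooth_on S f \<Longrightarrow> smooth_on S g \<Longrightarrow> smooth_on S (\<lambda>x. h (f x) (g x))"
  by (simp add: smooth_on_iff_diff_order diff_order_bilinear)

lemmas smooth_on_mult = smooth_on_bilinear[OF bounded_bilinear_mult]
lemmas smooth_on_inner = smooth_on_bilinear[OF bounded_bilinear_inner]
lemmas smooth_on_fst = smooth_on_bounded_linear[OF bounded_linear_fst]
lemmas smooth_on_snd = smooth_on_bounded_linear[OF bounded_linear_snd]

lemma smooth_on_diff:
  assumes "open S" "smooth_on S f" "smooth_on S g"
  shows "smooth_on S (\<lambda>x. f x - g x)"
  using smooth_on_add[OF assms(1,2) smooth_on_bounded_linear[OF bounded_linear_minus[OF bounded_linear_ident] assms(1,3)]]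
  by simp

lemma smooth_on_Pair:
  assumes "open S" "smooth_on S f" "smooth_on S g"
  shows "smooth_on S (\<lambda>x. (f x, g x))"
proof -
  have "smooth_on S (\<lambda>x. (f x, 0) + (0, g x))"
    using assms by (intro smooth_on_add smooth_on_bounded_linear[where L = "\<lambda>u. (u, 0)"]
        smooth_on_bounded_linear[where L = "\<lambda>u. (0, u)"] bounded_linear_Pair bounded_linear_ident bounded_linear_zero)
  then show ?thesis by simp
qed

lemma smooth_on_compose:
  fixes g :: "'a::real_normed_vector \<Rightarrow> 'b::euclidean_space" and f :: "'b \<Rightarrow> 'c::real_normed_vector"
  shows "open S \<Longrightarrow> open T \<Longrightarrow> g ` S \<subseteq> T \<Longrightarrow> smooth_on T f \<Longrightarrow> smooth_on S g \<Longrightarrow> smooth_on S (\<lambda>x. f (g x))"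
  using diff_order_compose unfolding smooth_on_iff_diff_order by blast

text \<open>
  The derivative of the inverse is a polynomial in the inverse, so each order follows from the one
  before. For the square root below, the derivative is the inverse of the square root, a composite.
\<close>

lemma diff_order_inverse: "diff_order k {0<..} (inverse :: real \<Rightarrow> real)"
proof (induction k)
  case (Suc k)
  have d: "(inverse has_derivative (\<lambda>v. - v * (inverse x * inverse x))) (at x)" if "x > 0" for x :: real
    using that by (auto intro!: derivative_eq_intros)
  have "diff_order k {0<..} (dir_deriv v (inverse :: real \<Rightarrow> real))" for v
    by (rule diff_order_cong[OF _ _ diff_order_bilinear[OF bounded_bilinear_mult _ diff_order_const[of k _ "- v"]
            diff_order_bilinear[OF bounded_bilinear_mult _ Suc.IH Suc.IH]]])
       (use dir_deriv_eq[OF d] in auto)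
  then show ?case using d unfolding diff_order.simps differentiable_def by auto
qed (auto intro!: derivative_intros)

lemma diff_order_sqrt: "diff_order k {0<..} sqrt"
proof (induction k)
  case (Suc k)
  have d: "(sqrt has_derivative (\<lambda>v. (v / 2) * inverse (sqrt x))) (at x)" if "x > 0" for x
    using that by (auto intro!: derivative_eq_intros simp: field_simps)
  have "diff_order k {0<..} (dir_deriv v sqrt)" for v
    by (rule diff_order_cong[OF _ _ diff_order_bilinear[OF bounded_bilinear_mult _ diff_order_const[of k _ "v / 2"]
            diff_order_compose[OF _ _ _ diff_order_inverse Suc.IH]]])
       (use dir_deriv_eq[OF d] in auto)
  then show ?case using d unfolding diff_order.simps differentiable_def by auto
next
  case 0
  show ?case using DERIV_real_sqrt unfolding diff_order.simps differentiable_def has_field_derivative_def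
    by blast
qed

lemma smooth_on_inverse:
  fixes f :: "'a::real_normed_vector \<Rightarrow> real"
  assumes "open S" "\<And>x. x \<in> S \<Longrightarrow> f x > 0" "smooth_on S f"
  shows "smooth_on S (\<lambda>x. inverse (f x))"
  by (rule smooth_on_compose[where T = "{0<..}"])
     (use assms diff_order_inverse in \<open>auto simp: smooth_on_iff_diff_order\<close>)

lemma smooth_on_sqrt:
  fixes f :: "'a::real_normed_vector \<Rightarrow> real"
  assumes "open S" "\<And>x. x \<in> S \<Longrightarrow> f x > 0" "smooth_on S f"
  shows "smooth_on S (\<lambda>x. sqrt (f x))"
  by (rule smooth_on_compose[where T = "{0<..}"])
     (use assms diff_order_sqrt in \<open>auto simp: smooth_on_iff_diff_order\<close>)

section \<open>Symmetry of second derivatives\<close>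

text \<open>
  Two applications of the mean value theorem, the first along \<open>u\<close> to
  \<open>t \<mapsto> f (x + s v + t u) - f (x + t u)\<close> and the second along \<open>v\<close>, turn the second difference into
  \<open>s\<^sup>2\<close> times the mixed derivative at a point within \<open>s (|u| + |v|)\<close> of \<open>x\<close>.
\<close>

lemma second_difference_quotient_tendsto:
  fixes f :: "'a::real_normed_vector \<Rightarrow> real"
  assumes S: "open S" "x \<in> S" and f: "smooth_on S f"
  shows "((\<lambda>s. (f (x + s *\<^sub>R u + s *\<^sub>R v) - f (x + s *\<^sub>R u) - f (x + s *\<^sub>R v) + f x) / s\<^sup>2)
           \<longlongrightarrow> dir_deriv v (dir_deriv u f) x) (at_right 0)"
proof (rule tendstoI)
  fix e :: real assume "e > 0"
  let ?h = "dir_deriv v (dir_deriv u f)"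
  have "isCont ?h x"
    using smooth_on_differentiable[OF smooth_on_dir_deriv[OF smooth_on_dir_deriv[OF f]] S(2)]
    by (rule differentiable_imp_continuous_within)
  then obtain d1 where d1: "d1 > 0" "\<And>z. dist z x < d1 \<Longrightarrow> dist (?h z) (?h x) < e"
    using \<open>e > 0\<close> unfolding continuous_at_eps_delta by blast
  obtain d2 where d2: "d2 > 0" "ball x d2 \<subseteq> S"
    using S unfolding open_contains_ball by blast
  define d where "d = min d1 d2 / (norm u + norm v + 1)"
  have d: "d > 0" using d1 d2 by (simp add: d_def add_nonneg_pos)
  have near: "dist (x + a *\<^sub>R u + b *\<^sub>R v) x < min d1 d2" if "0 \<le> a" "a < d" "0 \<le> b" "b < d" for a b
  proof -
    have "norm (a *\<^sub>R u + b *\<^sub>R v) \<le> a * norm u + b * norm v"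
      using norm_triangle_ineq[of "a *\<^sub>R u" "b *\<^sub>R v"] that by simp
    also have "\<dots> \<le> d * norm u + d * norm v"
      using that by (intro add_mono mult_right_mono) auto
    also have "\<dots> < d * (norm u + norm v + 1)" using d by (simp add: algebra_simps)
    also have "\<dots> = min d1 d2"
      unfolding d_def by (simp add: add_nonneg_pos less_imp_neq[symmetric])
    finally show ?thesis by (simp add: dist_norm algebra_simps)
  qed
  have inS: "x + a *\<^sub>R u + b *\<^sub>R v \<in> S" if "0 \<le> a" "a < d" "0 \<le> b" "b < d" for a b
    using near[OF that] d2 by (auto simp: dist_commute mem_ball subset_eq)
  show "\<forall>\<^sub>F s in at_right 0. dist ((f (x + s *\<^sub>R u + s *\<^sub>R v) - f (x + s *\<^sub>R u) - f (x + s *\<^sub>R v) + f x) / s\<^sup>2) (?h x) < e"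
    unfolding eventually_at_right_field
  proof (intro exI conjI allI impI)
    show "0 < d" by fact
    fix s :: real assume s: "0 < s" "s < d"
    have line: "((\<lambda>t. g (z + t *\<^sub>R w)) has_real_derivative dir_deriv w g (z + t *\<^sub>R w)) (at t)"
      if "z + t *\<^sub>R w \<in> S" "smooth_on S g" for g :: "'a \<Rightarrow> real" and z w t
    proof -
      have D: "(g has_derivative frechet_derivative g (at (z + t *\<^sub>R w))) (at (z + t *\<^sub>R w))"
        using smooth_on_differentiable[OF that(2,1)] by (simp add: frechet_derivative_works)
      have "((\<lambda>t. z + t *\<^sub>R w) has_derivative (\<lambda>a. a *\<^sub>R w)) (at t)"
        by (auto intro!: derivative_eq_intros)
      from diff_chain_at[OF this D]
      have "((\<lambda>t. g (z + t *\<^sub>R w)) has_derivative (\<lambda>a. dir_deriv w g (z + t *\<^sub>R w) * a)) (at t)"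
        using linear_cmul[OF has_derivative_linear[OF D]] by (simp add: o_def mult.commute)
      then show ?thesis
        by (simp add: has_field_derivative_def)
    qed
    have "\<exists>t>0. t < s \<and>
       (f (x + s *\<^sub>R v + s *\<^sub>R u) - f (x + s *\<^sub>R u)) - (f (x + s *\<^sub>R v + 0 *\<^sub>R u) - f (x + 0 *\<^sub>R u)) =
       (s - 0) * (dir_deriv u f (x + s *\<^sub>R v + t *\<^sub>R u) - dir_deriv u f (x + t *\<^sub>R u))"
    proof (rule MVT2[OF s(1)])
      fix t :: real assume t: "0 \<le> t" "t \<le> s"
      show "((\<lambda>t. f (x + s *\<^sub>R v + t *\<^sub>R u) - f (x + t *\<^sub>R u)) has_real_derivative
         (dir_deriv u f (x + s *\<^sub>R v + t *\<^sub>R u) - dir_deriv u f (x + t *\<^sub>R u))) (at t)"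
        using inS[of t s] inS[of t 0] s t
        by (intro DERIV_diff line f) (auto simp: algebra_simps)
    qed
    then obtain t where t: "0 < t" "t < s" and
      e1: "f (x + s *\<^sub>R u + s *\<^sub>R v) - f (x + s *\<^sub>R u) - f (x + s *\<^sub>R v) + f x =
        s * (dir_deriv u f (x + t *\<^sub>R u + s *\<^sub>R v) - dir_deriv u f (x + t *\<^sub>R u))"
      by (auto simp: algebra_simps)
    have "\<exists>t'>0. t' < s \<and>
       dir_deriv u f (x + t *\<^sub>R u + s *\<^sub>R v) - dir_deriv u f (x + t *\<^sub>R u + 0 *\<^sub>R v) =
       (s - 0) * ?h (x + t *\<^sub>R u + t' *\<^sub>R v)"
    proof (rule MVT2[OF s(1)])
      fix t' :: real assume t': "0 \<le> t'" "t' \<le> s"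
      show "((\<lambda>t'. dir_deriv u f (x + t *\<^sub>R u + t' *\<^sub>R v)) has_real_derivative
         ?h (x + t *\<^sub>R u + t' *\<^sub>R v)) (at t')"
        using inS[of t t'] s t t' by (intro line smooth_on_dir_deriv f) auto
    qed
    then obtain t' where t': "0 < t'" "t' < s" and
      e2: "dir_deriv u f (x + t *\<^sub>R u + s *\<^sub>R v) - dir_deriv u f (x + t *\<^sub>R u) =
       s * ?h (x + t *\<^sub>R u + t' *\<^sub>R v)"
      by auto
    have "(f (x + s *\<^sub>R u + s *\<^sub>R v) - f (x + s *\<^sub>R u) - f (x + s *\<^sub>R v) + f x) / s\<^sup>2
        = ?h (x + t *\<^sub>R u + t' *\<^sub>R v)"
      using s unfolding e1 e2 by (simp add: power2_eq_square)
    then show "dist ((f (x + s *\<^sub>R u + s *\<^sub>R v) - f (x + s *\<^sub>R u) - f (x + s *\<^sub>R v) + f x) / s\<^sup>2) (?h x) < e"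
      using d1(2) near[of t t'] t t' s by auto
  qed
qed

text \<open>
  The second difference is symmetric in \<open>u\<close> and \<open>v\<close>, hence so is its limit.
\<close>

lemma dir_deriv_commute:
  fixes f :: "'a::real_normed_vector \<Rightarrow> real"
  assumes "open S" "x \<in> S" "smooth_on S f"
  shows "dir_deriv v (dir_deriv u f) x = dir_deriv u (dir_deriv v f) x"
proof (rule tendsto_unique[OF trivial_limit_at_right_real second_difference_quotient_tendsto[OF assms]])
  show "((\<lambda>s. (f (x + s *\<^sub>R u + s *\<^sub>R v) - f (x + s *\<^sub>R u) - f (x + s *\<^sub>R v) + f x) / s\<^sup>2)
           \<longlongrightarrow> dir_deriv u (dir_deriv v f) x) (at_right 0)"
    using second_difference_quotient_tendsto[OF assms, of v u] by (simp add: algebra_simps)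
qed

section \<open>Homogeneous functions on the slit tangent bundle\<close>

lemma dx_eq_dir_deriv: "dx i f = dir_deriv (axis i 1, 0) f"
  by (simp add: fun_eq_iff dx_def)

lemma dy_eq_dir_deriv: "dy i f = dir_deriv (0, axis i 1) f"
  by (simp add: fun_eq_iff dy_def)

lemma open_slit: "open U \<Longrightarrow> open (slit U)"
  unfolding slit_def by (intro open_Times open_Diff) auto

lemma smooth_on_dx: "smooth_on S f \<Longrightarrow> smooth_on S (dx i f)"
  unfolding dx_eq_dir_deriv by (rule smooth_on_dir_deriv)

lemma smooth_on_dy: "smooth_on S f \<Longrightarrow> smooth_on S (dy i f)"
  unfolding dy_eq_dir_deriv by (rule smooth_on_dir_deriv)

lemma dy_cong:
  assumes "open S" "p \<in> S" "\<And>q. q \<in> S \<Longrightarrow> f q = g q"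
  shows "dy i f p = dy i g p"
  unfolding dy_def using dir_deriv_cong[OF assms] by simp

lemma dy_commute:
  "open S \<Longrightarrow> p \<in> S \<Longrightarrow> smooth_on S f \<Longrightarrow> dy i (dy j f) p = dy j (dy i f) p"
  unfolding dy_eq_dir_deriv by (rule dir_deriv_commute)

lemma dx_dy_commute:
  "open S \<Longrightarrow> p \<in> S \<Longrightarrow> smooth_on S f \<Longrightarrow> dx i (dy j f) p = dy j (dx i f) p"
  unfolding dy_eq_dir_deriv dx_eq_dir_deriv by (rule dir_deriv_commute)

lemma linear_expand_axis:
  fixes D :: "real ^ 'n \<Rightarrow> real"
  assumes "linear D"
  shows "D w = (\<Sum>k\<in>UNIV. w $ k * D (axis k 1))"
proof -
  interpret linear D by fact
  have "w = (\<Sum>k\<in>UNIV. w $ k *\<^sub>R axis k 1)"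
    using basis_expansion[of w] by (simp add: scalar_mult_eq_scaleR)
  then have "D w = D (\<Sum>k\<in>UNIV. w $ k *\<^sub>R axis k 1)" by simp
  then show ?thesis by (simp add: sum scale)
qed

lemma fibre_derivative:
  assumes "f differentiable at p"
  shows "dir_deriv (0, w) f p = (\<Sum>k\<in>UNIV. w $ k * dy k f p)"
proof -
  have "linear (\<lambda>w. frechet_derivative f (at p) (0, w))"
    using linear_compose[OF bounded_linear.linear[OF bounded_linear_Pair[OF bounded_linear_zero bounded_linear_ident]]
        linear_frechet_derivative[OF assms]]
    by (simp add: o_def)
  from linear_expand_axis[OF this, of w] show ?thesis
    unfolding dy_def .
qed

lemma base_derivative:
  assumes "f differentiable at p"
  shows "dir_deriv (w, 0) f p = (\<Sum>k\<in>UNIV. w $ k * dx k f p)"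
proof -
  have "linear (\<lambda>w. frechet_derivative f (at p) (w, 0))"
    using linear_compose[OF bounded_linear.linear[OF bounded_linear_Pair[OF bounded_linear_ident bounded_linear_zero]]
        linear_frechet_derivative[OF assms]]
    by (simp add: o_def)
  from linear_expand_axis[OF this, of w] show ?thesis
    unfolding dx_def .
qed

text \<open>
  The zero section is left out because derivatives along the fibre are not controlled there.
\<close>

definition homogeneous_on :: "(real ^ 'n) set \<Rightarrow> nat \<Rightarrow> (('n::finite) tangent \<Rightarrow> real) \<Rightarrow> bool" where
  "homogeneous_on U m f \<longleftrightarrow> (\<forall>x\<in>U. \<forall>y. y \<noteq> 0 \<longrightarrow> (\<forall>l>0. f (x, l *\<^sub>R y) = l ^ m * f (x, y)))"

lemma homogeneous_onD:
  "homogeneous_on U m f \<Longrightarrow> x \<in> U \<Longrightarrow> y \<noteq> 0 \<Longrightarrow> l > 0 \<Longrightarrow> f (x, l *\<^sub>R y) = l ^ m * f (x, y)"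
  by (simp add: homogeneous_on_def)

text \<open>
  Differentiate the homogeneity relation \<open>f \<circ> A = l\<^sup>m f\<close>, where \<open>A\<close> multiplies the fibre coordinate
  by \<open>l\<close>: the chain rule scales the vertical part of the direction and leaves the horizontal part alone.
  So a horizontal derivative keeps the degree and a vertical one lowers it by one.
\<close>

lemma homogeneous_dir_deriv:
  assumes "open U" "homogeneous_on U m f" "smooth_on (slit U) f" "x \<in> U" "y \<noteq> 0" "l > 0"
  shows "dir_deriv (v, l *\<^sub>R w) f (x, l *\<^sub>R y) = l ^ m * dir_deriv (v, w) f (x, y)"
proof -
  define A where "A = (\<lambda>q :: 'a tangent. (fst q, l *\<^sub>R snd q))"
  have "bounded_linear A"
    unfolding A_def by (intro bounded_linear_Pair bounded_linear_fst bounded_linear_snd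
        bounded_linear_compose[OF bounded_linear_scaleR_right])
  then have A: "(A has_derivative A) (at (x, y))"
    by (rule bounded_linear_imp_has_derivative)
  have p: "(x, y) \<in> slit U" "A (x, y) \<in> slit U"
    using assms by (auto simp: slit_def A_def)
  have "(f has_derivative frechet_derivative f (at (A (x, y)))) (at (A (x, y)))"
    using smooth_on_differentiable[OF assms(3) p(2)] by (simp add: frechet_derivative_works)
  from diff_chain_at[OF A this]
  have 1: "((\<lambda>q. f (A q)) has_derivative (\<lambda>q. frechet_derivative f (at (A (x, y))) (A q))) (at (x, y))"
    by (simp add: o_def)
  have "(f has_derivative frechet_derivative f (at (x, y))) (at (x, y))"
    using smooth_on_differentiable[OF assms(3) p(1)] by (simp add: frechet_derivative_works)
  then have "((\<lambda>q. l ^ m * f q) has_derivative (\<lambda>q. l ^ m * frechet_derivative f (at (x, y)) q)) (at (x, y))"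
    by (rule has_derivative_mult_right)
  then have 2: "((\<lambda>q. f (A q)) has_derivative (\<lambda>q. l ^ m * frechet_derivative f (at (x, y)) q)) (at (x, y))"
  proof (rule has_derivative_transform_within_open[OF _ open_slit[OF assms(1)] p(1)])
    show "l ^ m * f q = f (A q)" if "q \<in> slit U" for q
    proof -
      have "fst q \<in> U" "snd q \<noteq> 0"
        using that by (auto simp: slit_def)
      from homogeneous_onD[OF assms(2) this assms(6)] show ?thesis
        by (simp add: A_def)
    qed
  qed
  show ?thesis
    using fun_cong[OF has_derivative_unique[OF 1 2], of "(v, w)"] by (simp add: A_def)
qed

lemma homogeneous_dx:
  assumes "open U" "smooth_on (slit U) f" "homogeneous_on U m f"
  shows "homogeneous_on U m (dx i f)"
  using homogeneous_dir_deriv[OF assms(1,3,2), of _ _ _ "axis i 1" 0]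
  by (simp add: homogeneous_on_def dx_def)

lemma homogeneous_dy:
  assumes "open U" "smooth_on (slit U) f" "homogeneous_on U (Suc m) f"
  shows "homogeneous_on U m (dy i f)"
  unfolding homogeneous_on_def
proof (intro ballI allI impI)
  fix x y :: "real ^ 'a" and l :: real
  assume *: "x \<in> U" "y \<noteq> 0" "l > 0"
  then have "(x, l *\<^sub>R y) \<in> slit U" by (simp add: slit_def)
  from linear_cmul[OF linear_frechet_derivative[OF smooth_on_differentiable[OF assms(2) this]],
      of l "(0, axis i 1)"]
  have "l * dy i f (x, l *\<^sub>R y) = l * (l ^ m * dy i f (x, y))"
    using homogeneous_dir_deriv[OF assms(1,3,2) *, of 0 "axis i 1"] by (auto simp: dy_def)
  then show "dy i f (x, l *\<^sub>R y) = l ^ m * dy i f (x, y)"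
    using * by simp
qed

lemma euler_homogeneous:
  assumes "smooth_on (slit U) f" "homogeneous_on U m f" "p \<in> slit U"
  shows "(\<Sum>k\<in>UNIV. snd p $ k * dy k f p) = m * f p"
proof -
  obtain x y where p: "p = (x, y)" by (cases p)
  have xy: "x \<in> U" "y \<noteq> 0" using assms(3) by (auto simp: p slit_def)
  have diff: "f differentiable at (x, y)"
    using smooth_on_differentiable[OF assms(1,3)] by (simp add: p)
  have line: "((\<lambda>t. (x, t *\<^sub>R y)) has_derivative (\<lambda>a. (0, a *\<^sub>R y))) (at 1)"
    by (auto intro!: derivative_eq_intros)
  have D: "(f has_derivative frechet_derivative f (at (x, y))) (at (x, 1 *\<^sub>R y))"
    using diff by (simp add: frechet_derivative_works)
  have 1: "((\<lambda>t. f (x, t *\<^sub>R y)) has_derivative (\<lambda>a. frechet_derivative f (at (x, y)) (0, a *\<^sub>R y))) (at 1)"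
    using diff_chain_at[OF line D] by (simp add: o_def)
  have "((\<lambda>t. t ^ m * f (x, y)) has_derivative (\<lambda>a. a * (m * f (x, y)))) (at (1::real))"
    by (auto intro!: derivative_eq_intros simp: fun_eq_iff algebra_simps)
  then have 2: "((\<lambda>t. f (x, t *\<^sub>R y)) has_derivative (\<lambda>a. a * (m * f (x, y)))) (at 1)"
    by (rule has_derivative_transform_within_open[of _ _ _ _ "{0<..}"])
       (use xy in \<open>auto simp: homogeneous_onD[OF assms(2)]\<close>)
  show ?thesis
    using fun_cong[OF has_derivative_unique[OF 1 2], of 1] fibre_derivative[OF diff, of y]
    by (simp add: p)
qed

text \<open>
  The derivative of \<open>f\<close> along the geodesic field of the flat connection, often written
  \<open>f\<^sub>0 = y\<^sup>k \<partial>\<^sub>k f\<close>.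
\<close>

definition drift :: "(('n::finite) tangent \<Rightarrow> real) \<Rightarrow> 'n tangent \<Rightarrow> real" where
  "drift f p = (\<Sum>k\<in>UNIV. snd p $ k * dx k f p)"

lemma bounded_linear_fibre_coord: "bounded_linear (\<lambda>p :: ('n::finite) tangent. snd p $ k)"
  using bounded_linear_compose[OF bounded_linear_vec_nth bounded_linear_snd] .

lemma smooth_on_drift:
  assumes "open S" "smooth_on S f"
  shows "smooth_on S (drift f)"
  unfolding drift_def[abs_def]
  by (intro smooth_on_sum smooth_on_mult smooth_on_dx assms
      smooth_on_bounded_linear[OF bounded_linear_fibre_coord _ smooth_on_ident])

lemma dy_drift:
  assumes "smooth_on S f" "p \<in> S"
  shows "dy i (drift f) p = dx i f p + (\<Sum>k\<in>UNIV. snd p $ k * dy i (dx k f) p)"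
proof -
  let ?D = "\<lambda>k. frechet_derivative (dx k f) (at p)"
  have "((\<lambda>q. snd q $ k * dx k f q) has_derivative (\<lambda>v. snd p $ k * ?D k v + snd v $ k * dx k f p)) (at p)" for k
    by (intro has_derivative_mult bounded_linear_imp_has_derivative bounded_linear_fibre_coord
        differentiable_has_dir_deriv smooth_on_differentiable[OF smooth_on_dx[OF assms(1)] assms(2)])
  then have "(drift f has_derivative (\<lambda>v. \<Sum>k\<in>UNIV. snd p $ k * ?D k v + snd v $ k * dx k f p)) (at p)"
    unfolding drift_def[abs_def] by (intro has_derivative_sum)
  from dir_deriv_eq[OF this, of "(0, axis i 1)"] show ?thesis
    by (simp add: dy_def sum.distrib axis_def if_distrib[of "\<lambda>c. c * _"] cong: if_cong)
qed

lemma homogeneous_drift: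
  assumes "open U" "smooth_on (slit U) f" "homogeneous_on U m f"
  shows "homogeneous_on U (Suc m) (drift f)"
  using homogeneous_dx[OF assms]
  by (simp add: homogeneous_on_def drift_def sum_distrib_left algebra_simps)

section \<open>Dual flatness and the Landsberg property\<close>

lemma smooth_on_square: "open S \<Longrightarrow> smooth_on S F \<Longrightarrow> smooth_on S (sq F)"
  unfolding power2_eq_square by (rule smooth_on_mult)

lemma homogeneous_square: "homogeneous_on U 1 F \<Longrightarrow> homogeneous_on U 2 (sq F)"
  by (simp add: homogeneous_on_def power_mult_distrib)

text \<open>
  Dual flatness makes the covariant spray coefficients the vertical gradient of this function; the
  factor is forced by that normalisation.
\<close>

definition cubic_potential :: "(('n::finite) tangent \<Rightarrow> real) \<Rightarrow> 'n tangent \<Rightarrow> real" where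
  "cubic_potential F p = 1/12 * drift (sq F) p"

lemma smooth_on_cubic_potential:
  "open U \<Longrightarrow> smooth_on (slit U) F \<Longrightarrow> smooth_on (slit U) (cubic_potential F)"
  unfolding cubic_potential_def[abs_def]
  by (intro smooth_on_mult smooth_on_const smooth_on_drift smooth_on_square open_slit)

lemma homogeneous_cubic_potential:
  assumes "open U" "smooth_on (slit U) F" "homogeneous_on U 1 F"
  shows "homogeneous_on U 3 (cubic_potential F)"
  using homogeneous_drift[OF assms(1) smooth_on_square[OF open_slit[OF assms(1)] assms(2)] homogeneous_square[OF assms(3)]]
  by (simp add: homogeneous_on_def cubic_potential_def numeral_3_eq_3)

lemma dy_cmult:
  assumes "f differentiable at p"
  shows "dy i (\<lambda>q. c * f q) p = c * dy i f p"
  using dir_deriv_eq[OF has_derivative_mult_right[OF differentiable_has_dir_deriv[OF assms]]]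
  by (simp add: dy_def)

text \<open>
  Differentiating \<open>y\<^sup>k \<partial>\<^sub>k F\<^sup>2\<close> vertically gives \<open>\<partial>\<^sub>i F\<^sup>2\<close> from the explicit \<open>y\<close> and, by the
  dual flatness equation, twice that from the rest.
\<close>

lemma dy_cubic_potential:
  assumes "open U" "smooth_on (slit U) F" "dual_flat_eqs U F" "p \<in> slit U"
  shows "dy i (cubic_potential F) p = 1/4 * dx i (sq F) p"
proof -
  have sm: "smooth_on (slit U) (sq F)"
    using assms by (intro smooth_on_square open_slit)
  have "dy i (drift (sq F)) p = 3 * dx i (sq F) p"
    using dy_drift[OF sm assms(4), of i] assms(3,4) unfolding dual_flat_eqs_def by force
  moreover have "dy i (cubic_potential F) p = 1/12 * dy i (drift (sq F)) p"
    unfolding cubic_potential_def[abs_def]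
    by (rule dy_cmult[OF smooth_on_differentiable[OF smooth_on_drift[OF open_slit[OF assms(1)] sm] assms(4)]])
  ultimately show ?thesis by simp
qed

text \<open>
  The bracket in the definition of the spray has the two derivatives in the opposite order to the
  dual flatness equation; once they are interchanged it equals \<open>2 \<partial>\<^sub>h F\<^sup>2 - \<partial>\<^sub>h F\<^sup>2\<close>.
\<close>

lemma spray_dual_flat:
  assumes "open U" "smooth_on (slit U) F" "dual_flat_eqs U F" "p \<in> slit U"
  shows "spray F i p =
    (\<Sum>h\<in>UNIV. matrix_inv (fund_tensor F p) $ i $ h * dy h (cubic_potential F) p)"
proof -
  have sm: "smooth_on (slit U) (sq F)"
    using assms by (intro smooth_on_square open_slit)
  have "(\<Sum>r\<in>UNIV. snd p $ r * dx r (dy h (sq F)) p) - dx h (sq F) p = 4 * dy h (cubic_potential F) p" for h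
    using assms(3,4) dx_dy_commute[OF open_slit[OF assms(1)] assms(4) sm] dy_cubic_potential[OF assms, of h]
    unfolding dual_flat_eqs_def by force
  then show ?thesis
    unfolding spray_def by (simp add: sum_distrib_left)
qed

lemma matrix_inv_right:
  fixes A :: "real ^ 'n ^ 'n"
  assumes "invertible A"
  shows "A ** matrix_inv A = mat 1"
  using someI_ex[OF assms[unfolded invertible_def]] by (simp add: matrix_inv_def)

lemma covariant_coeff_dual_flat:
  assumes "open U" "smooth_on (slit U) F" "dual_flat_eqs U F" "p \<in> slit U"
    and "invertible (fund_tensor F p)"
  shows "covariant_coeff F i p = dy i (cubic_potential F) p"
proof -
  let ?g = "fund_tensor F p"
  define v where "v = (\<chi> h. dy h (cubic_potential F) p)"
  have "(\<chi> r. spray F r p) = matrix_inv ?g *v v"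
    by (simp add: vec_eq_iff spray_dual_flat[OF assms(1-4)] matrix_vector_mult_def v_def)
  then have "?g *v (\<chi> r. spray F r p) = v"
    by (simp add: matrix_vector_mul_assoc matrix_inv_right[OF assms(5)])
  then show ?thesis
    by (simp add: vec_eq_iff covariant_coeff_def matrix_vector_mult_def v_def)
qed

lemma finsler_smooth: "finsler_metric U F \<Longrightarrow> smooth_on (slit U) F"
  and finsler_homogeneous: "finsler_metric U F \<Longrightarrow> homogeneous_on U 1 F"
  by (simp_all add: finsler_metric_def homogeneous_on_def)

lemma H4_dual_flat:
  assumes "open U" "finsler_metric U F" "dual_flat_eqs U F" "p \<in> slit U"
  shows "H4 F i j k h p = dy h (dy k (dy j (dy i (cubic_potential F)))) p"
proof -
  note O = open_slit[OF assms(1)]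
  have "covariant_coeff F i q = dy i (cubic_potential F) q" if "q \<in> slit U" for q
    using assms that by (intro covariant_coeff_dual_flat[where U = U]) (auto simp: finsler_metric_def)
  then have "dy j (covariant_coeff F i) q = dy j (dy i (cubic_potential F)) q" if "q \<in> slit U" for q
    using dy_cong[OF O that] by blast
  then have "dy k (dy j (covariant_coeff F i)) q = dy k (dy j (dy i (cubic_potential F))) q" if "q \<in> slit U" for q
    using dy_cong[OF O that] by blast
  then show ?thesis
    unfolding H4_def using dy_cong[OF O assms(4)] by blast
qed

text \<open>
  Move the derivative belonging to the contracted index outermost. The third vertical derivatives of a
  function of degree three have degree zero, and Euler's identity annihilates them.
\<close>

lemma dual_flat_imp_H_Landsberg:
  assumes "open U" "finsler_metric U F" "dual_flat_eqs U F"
  shows "H_Landsberg U F"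
  unfolding H_Landsberg_def
proof (intro ballI allI)
  fix p :: "'a tangent" and j k h
  assume p: "p \<in> slit U"
  define P where "P = cubic_potential F"
  note O = open_slit[OF assms(1)]
  have sm: "smooth_on (slit U) P"
    unfolding P_def using assms(1) finsler_smooth[OF assms(2)] by (rule smooth_on_cubic_potential)
  note sm1 = smooth_on_dy[OF sm] note sm2 = smooth_on_dy[OF sm1] note sm3 = smooth_on_dy[OF sm2]
  have "homogeneous_on U 3 P"
    unfolding P_def using assms(1) finsler_smooth[OF assms(2)] finsler_homogeneous[OF assms(2)]
    by (rule homogeneous_cubic_potential)
  then have hom: "homogeneous_on U 0 (dy h (dy k (dy j P)))"
    using assms(1) sm sm1 sm2 by (simp add: homogeneous_dy numeral_3_eq_3)
  have "H4 F i j k h p = dy i (dy h (dy k (dy j P))) p" for i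
  proof -
    have 1: "dy j (dy i P) q = dy i (dy j P) q" if "q \<in> slit U" for q
      using O that sm by (rule dy_commute)
    have 2: "dy k (dy j (dy i P)) q = dy i (dy k (dy j P)) q" if "q \<in> slit U" for q
      by (rule trans[OF dy_cong[OF O that 1] dy_commute[OF O that sm1]])
    show ?thesis
      unfolding H4_dual_flat[OF assms p] P_def[symmetric]
      by (rule trans[OF dy_cong[OF O p 2] dy_commute[OF O p sm2]])
  qed
  then show "(\<Sum>i\<in>UNIV. snd p $ i * H4 F i j k h p) = 0"
    using euler_homogeneous[OF sm3 hom p] by simp
qed

section \<open>Quadratic coefficients force a Euclidean metric\<close>

text \<open>
  A punctured real vector space is connected only from dimension two on.
\<close>

lemma fibre_constant:
  fixes f :: "('n::finite) tangent \<Rightarrow> real"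
  assumes "CARD('n) \<ge> 2" "smooth_on (slit U) f" "\<And>p i. p \<in> slit U \<Longrightarrow> dy i f p = 0"
    and "x \<in> U" "y \<noteq> 0" "z \<noteq> 0"
  shows "f (x, y) = f (x, z)"
proof -
  have "((\<lambda>y. f (x, y)) has_derivative (\<lambda>h. 0)) (at w)" if "w \<in> UNIV - {0}" for w
  proof -
    have p: "(x, w) \<in> slit U"
      using that assms(4) by (simp add: slit_def)
    have diff: "f differentiable at (x, w)"
      using assms(2) p by (rule smooth_on_differentiable)
    have "((\<lambda>y. (x, y)) has_derivative (\<lambda>h. (0, h))) (at w)"
      by (auto intro!: derivative_eq_intros)
    from diff_chain_at[OF this differentiable_has_dir_deriv[OF diff]] show ?thesis
      using fibre_derivative[OF diff] assms(3)[OF p] by (simp add: o_def)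
  qed
  moreover have "connected (UNIV - {0 :: real ^ 'n})"
    using connected_punctured_universe[of "0 :: real ^ 'n"] assms(1) by (simp add: Compl_eq_Diff_UNIV)
  ultimately show ?thesis
    using assms(5,6)
    by (intro has_derivative_zero_unique_connected[of "UNIV - {0}" "\<lambda>y. f (x, y)"]) auto
qed

text \<open>
  Three applications of Euler's identity express \<open>P\<close> through its third derivatives. These are constant
  on the punctured fibre, so \<open>P\<close> is a homogeneous cubic polynomial in \<open>y\<close>.
\<close>

lemma odd_if_fourth_derivatives_vanish:
  fixes P :: "('n::finite) tangent \<Rightarrow> real"
  assumes "CARD('n) \<ge> 2" "open U" "smooth_on (slit U) P" "homogeneous_on U 3 P"
    and "\<And>p i j k h. p \<in> slit U \<Longrightarrow> dy h (dy k (dy j (dy i P))) p = 0"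
    and "x \<in> U" "y \<noteq> 0"
  shows "P (x, - y) = - P (x, y)"
proof -
  note sm1 = smooth_on_dy[OF assms(3)] note sm2 = smooth_on_dy[OF sm1] note sm3 = smooth_on_dy[OF sm2]
  have hom1: "homogeneous_on U 2 (dy i P)" for i
    using assms(2-4) by (simp add: homogeneous_dy numeral_3_eq_3 numeral_2_eq_2)
  have hom2: "homogeneous_on U 1 (dy j (dy i P))" for i j
    using assms(2) sm1 hom1 by (simp add: homogeneous_dy numeral_2_eq_2)
  have expand: "6 * P (x, w) = (\<Sum>i\<in>UNIV. \<Sum>j\<in>UNIV. \<Sum>k\<in>UNIV.
      w $ i * w $ j * w $ k * dy k (dy j (dy i P)) (x, w))" if "w \<noteq> 0" for w
  proof -
    have p: "(x, w) \<in> slit U"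
      using that assms(6) by (simp add: slit_def)
    have "6 * P (x, w) = 2 * (\<Sum>i\<in>UNIV. w $ i * dy i P (x, w))"
      using euler_homogeneous[OF assms(3,4) p] by simp
    also have "\<dots> = (\<Sum>i\<in>UNIV. w $ i * (\<Sum>j\<in>UNIV. w $ j * dy j (dy i P) (x, w)))"
      using euler_homogeneous[OF sm1 hom1 p] by (simp add: sum_distrib_left mult.left_commute)
    also have "\<dots> = (\<Sum>i\<in>UNIV. w $ i * (\<Sum>j\<in>UNIV. w $ j *
        (\<Sum>k\<in>UNIV. w $ k * dy k (dy j (dy i P)) (x, w))))"
      using euler_homogeneous[OF sm2 hom2 p] by simp
    finally show ?thesis
      by (simp add: sum_distrib_left mult.assoc)
  qed
  have "dy k (dy j (dy i P)) (x, - y) = dy k (dy j (dy i P)) (x, y)" for i j k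
    using assms(5-7) by (intro fibre_constant[OF assms(1) sm3]) auto
  then have "6 * P (x, - y) = - (6 * P (x, y))"
    using expand[of y] expand[of "- y"] assms(7) by (simp add: sum_negf)
  then show ?thesis by simp
qed

text \<open>
  With \<open>F\<^sub>0 = y\<^sup>k \<partial>\<^sub>k F\<close>, projective flatness says that the vertical gradient of \<open>F\<^sub>0\<close> is
  \<open>2 \<partial>\<^sub>i F\<close>, and dual flatness says that the vertical gradient of \<open>2 F F\<^sub>0\<close> is \<open>6 F \<partial>\<^sub>i F\<close>. Eliminating
  \<open>\<partial>\<^sub>i F\<close> leaves the statement that the vertical gradient of \<open>F\<^sub>0 / F\<^sup>2\<close> vanishes.
\<close>

lemma flat_drift_proportional:
  fixes F :: "('n::finite) tangent \<Rightarrow> real"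
  assumes "CARD('n) \<ge> 2" "open U" "finsler_metric U F" "projectively_flat U F" "dual_flat_eqs U F"
    and "x \<in> U" "y \<noteq> 0" "z \<noteq> 0"
  shows "drift F (x, y) / (F (x, y))\<^sup>2 = drift F (x, z) / (F (x, z))\<^sup>2"
proof -
  note O = open_slit[OF assms(2)]
  note sm = finsler_smooth[OF assms(3)]
  have pos: "F p > 0" if "p \<in> slit U" for p
    using that assms(3) by (auto simp: finsler_metric_def slit_def order_less_le)
  have D: "(f has_derivative (\<lambda>v. frechet_derivative f (at p) v)) (at p)"
    if "smooth_on (slit U) f" "p \<in> slit U" for p and f :: "'n tangent \<Rightarrow> real"
    using smooth_on_differentiable[OF that] by (rule differentiable_has_dir_deriv)
  have smd: "smooth_on (slit U) (drift F)"
    using O sm by (rule smooth_on_drift)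
  have dsq: "dx i (sq F) p = 2 * F p * dx i F p" "dy i (sq F) p = 2 * F p * dy i F p" if "p \<in> slit U" for i p
    using dir_deriv_eq[OF has_derivative_power[OF D[OF sm that], of 2]] by (simp_all add: dx_def dy_def)
  have drift_sq: "drift (sq F) p = 2 * F p * drift F p" if "p \<in> slit U" for p
    by (simp add: drift_def dsq[OF that] sum_distrib_left algebra_simps)
  \<comment> \<open>Up to a factor \<open>F\<close>, the vanishing of the numerator in the quotient rule for \<open>F\<^sub>0 / F\<^sup>2\<close>.\<close>
  have key: "F p * dy i (drift F) p = 2 * drift F p * dy i F p" if p: "p \<in> slit U" for i p
  proof -
    have a: "dy i (drift F) p = 2 * dx i F p"
      using dy_drift[OF sm p, of i] assms(4) p unfolding projectively_flat_def by force
    have "dy i (drift (sq F)) p = 3 * dx i (sq F) p"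
      using dy_drift[OF smooth_on_square[OF O sm] p, of i] assms(5) p unfolding dual_flat_eqs_def by force
    then have b: "dy i (drift (sq F)) p = 6 * F p * dx i F p"
      by (simp add: dsq[OF p])
    have "dy i (drift (sq F)) p = dy i (\<lambda>q. 2 * F q * drift F q) p"
      using O p drift_sq by (rule dy_cong)
    also have "\<dots> = 2 * F p * dy i (drift F) p + 2 * dy i F p * drift F p"
      using dir_deriv_eq[OF has_derivative_mult[OF has_derivative_mult_right[OF D[OF sm p], of 2] D[OF smd p]]]
      by (simp add: dy_def)
    finally show ?thesis
      using a b by simp
  qed
  let ?c = "\<lambda>p. drift F p * inverse ((F p)\<^sup>2)"
  have "?c (x, y) = ?c (x, z)"
  proof (rule fibre_constant[OF assms(1)])
    show "smooth_on (slit U) ?c"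
      using pos by (intro smooth_on_mult smooth_on_inverse smd O smooth_on_square[OF O sm]) (simp add: less_imp_neq[symmetric])
    fix p i assume p: "p \<in> slit U"
    have nz: "F p \<noteq> 0" using pos[OF p] by simp
    have "((\<lambda>p. drift F p / (F p)\<^sup>2) has_derivative
      (\<lambda>v. (frechet_derivative (drift F) (at p) v * (F p)\<^sup>2 - drift F p * (2 * F p * frechet_derivative F (at p) v)) /
        ((F p)\<^sup>2 * (F p)\<^sup>2))) (at p)"
      using nz has_derivative_power[OF D[OF sm p], of 2]
      by (intro has_derivative_divide' D[OF smd p]) (auto simp: algebra_simps)
    then have "dy i ?c p = (dy i (drift F) p * (F p)\<^sup>2 - drift F p * (2 * F p * dy i F p)) / ((F p)\<^sup>2 * (F p)\<^sup>2)"
      using dir_deriv_eq by (simp add: dy_def divide_inverse)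
    also have "dy i (drift F) p * (F p)\<^sup>2 - drift F p * (2 * F p * dy i F p) = 0"
      using key[OF p, of i] by (simp add: power2_eq_square algebra_simps)
    finally show "dy i ?c p = 0" by simp
  qed (use assms in auto)
  then show ?thesis by (simp add: divide_inverse)
qed

text \<open>
  On each fibre the cubic potential is a constant multiple of \<open>F\<^sup>3\<close>. If the covariant coefficients
  are quadratic, the potential is odd, whereas \<open>F\<close> is positive; so the multiple is zero. Then
  \<open>y\<^sup>k \<partial>\<^sub>k F\<close> vanishes identically, and so does its vertical gradient \<open>2 \<partial>\<^sub>i F\<close>.
\<close>

lemma flat_H_Berwald_imp_dx_eq_0:
  fixes F :: "('n::finite) tangent \<Rightarrow> real"
  assumes n: "CARD('n) \<ge> 2" and U: "open U" and F: "finsler_metric U F"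
    and pf: "projectively_flat U F" and df: "dual_flat_eqs U F" and HB: "H_Berwald U F"
    and p: "p \<in> slit U"
  shows "dx i F p = 0"
proof -
  note O = open_slit[OF U]
  note sm = finsler_smooth[OF F]
  have drift0: "drift F (x, y) = 0" if xy: "x \<in> U" "y \<noteq> 0" for x y
  proof -
    have odd: "cubic_potential F (x, - y) = - cubic_potential F (x, y)"
      using HB H4_dual_flat[OF U F df] xy
      by (intro odd_if_fourth_derivatives_vanish[OF n U] smooth_on_cubic_potential
          homogeneous_cubic_potential U sm finsler_homogeneous[OF F]) (auto simp: H_Berwald_def)
    have pos: "F (x, w) > 0" if "w \<noteq> 0" for w
      using that xy F by (auto simp: finsler_metric_def order_less_le)
    have drift_sq: "drift (sq F) (x, w) = 2 * F (x, w) * drift F (x, w)" if "w \<noteq> 0" for w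
    proof -
      have "(x, w) \<in> slit U" using that xy by (simp add: slit_def)
      note D = differentiable_has_dir_deriv[OF smooth_on_differentiable[OF sm this]]
      show ?thesis
        using dir_deriv_eq[OF has_derivative_power[OF D, of 2]]
        by (simp add: drift_def dx_def sum_distrib_left algebra_simps)
    qed
    define c where "c = drift F (x, y) / (F (x, y))\<^sup>2"
    have "drift F (x, w) = c * (F (x, w))\<^sup>2" if "w \<noteq> 0" for w
      using flat_drift_proportional[OF n U F pf df xy that] pos[OF that]
      by (simp add: c_def field_simps)
    then have "6 * cubic_potential F (x, w) = c * F (x, w) ^ 3" if "w \<noteq> 0" for w
      using drift_sq[OF that] that by (simp add: cubic_potential_def power2_eq_square power3_eq_cube)
    from this[of y] this[of "- y"] have "c * (F (x, y) ^ 3 + F (x, - y) ^ 3) = 0"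
      using odd xy by (simp add: algebra_simps)
    moreover have "F (x, y) ^ 3 + F (x, - y) ^ 3 > 0"
      using pos[of y] pos[of "- y"] xy by (simp add: add_pos_pos)
    ultimately have "c = 0" by simp
    then show ?thesis
      using pos[of y] xy by (simp add: c_def)
  qed
  have "dy i (drift F) p = dy i (\<lambda>q. 0) p"
    by (rule dy_cong[OF O p]) (use drift0 in \<open>auto simp: slit_def\<close>)
  then have "dy i (drift F) p = 0"
    by (simp add: dy_def)
  moreover have "dy i (drift F) p = 2 * dx i F p"
    using dy_drift[OF sm p, of i] pf p unfolding projectively_flat_def by force
  ultimately show ?thesis by simp
qed

text \<open>
  The metric does not depend on the base point, and at the centre of the ball a spherically symmetric
  metric is a multiple of the Euclidean norm.
\<close>

lemma flat_spherical_H_Berwald_imp_scaled_euclidean: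
  fixes F :: "('n::finite) tangent \<Rightarrow> real"
  assumes n: "CARD('n) \<ge> 2" and r0: "r0 > 0" and F: "finsler_metric (ball 0 r0) F"
    and ss: "spherically_symmetric r0 F"
    and pf: "projectively_flat (ball 0 r0) F" and df: "dual_flat_eqs (ball 0 r0) F"
    and HB: "H_Berwald (ball 0 r0) F"
  shows "scaled_euclidean r0 F"
proof -
  obtain \<phi> where \<phi>: "F (x, y) = norm y * \<phi> (norm x, (x \<bullet> y) / norm y)" if "x \<in> ball 0 r0" "y \<noteq> 0" for x y
    using ss unfolding spherically_symmetric_def by blast
  have indep: "F (x, y) = F (0, y)" if "x \<in> ball 0 r0" "y \<noteq> 0" for x y
  proof (rule has_derivative_zero_unique_connected[of "ball 0 r0" "\<lambda>x. F (x, y)"])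
    fix z :: "real ^ 'n" assume "z \<in> ball 0 r0"
    then have p: "(z, y) \<in> slit (ball 0 r0)"
      using that by (simp add: slit_def)
    have diff: "F differentiable at (z, y)"
      using finsler_smooth[OF F] p by (rule smooth_on_differentiable)
    have "((\<lambda>x. (x, y)) has_derivative (\<lambda>h. (h, 0))) (at z)"
      by (auto intro!: derivative_eq_intros)
    from diff_chain_at[OF this differentiable_has_dir_deriv[OF diff]]
    show "((\<lambda>x. F (x, y)) has_derivative (\<lambda>h. 0)) (at z)"
      using base_derivative[OF diff] flat_H_Berwald_imp_dx_eq_0[OF n open_ball F pf df HB p]
      by (simp add: o_def)
  qed (use that r0 in auto)
  have "F (x, y) = \<phi> (0, 0) * norm y" if "x \<in> ball 0 r0" for x y
  proof (cases "y = 0")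
    case True
    then show ?thesis using F that by (simp add: finsler_metric_def)
  next
    case False
    then show ?thesis using indep[OF that False] \<phi>[of 0 y] r0 by simp
  qed
  then show ?thesis
    unfolding scaled_euclidean_def by blast
qed

section \<open>Change of coordinates\<close>

lemma adapted_ident_imp_dual_flat:
  "adapted U F V (\<lambda>x. x) \<Longrightarrow> dual_flat_eqs V F"
  by (simp add: adapted_def in_coords_def)

text \<open>
  The differential of the parametrization enters as a function of base point and vector jointly, so it
  is first written as a finite sum of directional derivatives with the coordinates of \<open>y\<close> as
  coefficients. Its injectivity keeps the image inside the slit bundle, where \<open>F\<close> is smooth.
\<close>

lemma smooth_on_in_coords:
  fixes F :: "('n::finite) tangent \<Rightarrow> real"
  assumes "local_coords U V \<psi>" "open U" "smooth_on (slit U) F"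
  shows "smooth_on (slit V) (in_coords \<psi> F)"
proof -
  from assms(1) have V: "open V" "open (\<psi> ` V)" "\<psi> ` V \<subseteq> U" "inj_on \<psi> V" and sm: "smooth_on V \<psi>"
    and smi: "smooth_on (\<psi> ` V) (the_inv_into V \<psi>)"
    by (simp_all add: local_coords_def)
  note O = open_slit[OF V(1)]
  have inj: "frechet_derivative \<psi> (at x) y \<noteq> 0" if "x \<in> V" "y \<noteq> 0" for x y
  proof -
    have 1: "(\<psi> has_derivative frechet_derivative \<psi> (at x)) (at x)"
      using smooth_on_differentiable[OF sm that(1)] by (simp add: frechet_derivative_works)
    have 2: "(the_inv_into V \<psi> has_derivative frechet_derivative (the_inv_into V \<psi>) (at (\<psi> x))) (at (\<psi> x))"
      using smooth_on_differentiable[OF smi] that(1) by (simp add: frechet_derivative_works)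
    have "((\<lambda>z. z) has_derivative (frechet_derivative (the_inv_into V \<psi>) (at (\<psi> x)) \<circ> frechet_derivative \<psi> (at x))) (at x)"
      by (rule has_derivative_transform_within_open[OF diff_chain_at[OF 1 2] V(1) that(1)])
         (simp add: the_inv_into_f_f[OF V(4)])
    from fun_cong[OF has_derivative_unique[OF this has_derivative_ident], of y]
    have "frechet_derivative (the_inv_into V \<psi>) (at (\<psi> x)) (frechet_derivative \<psi> (at x) y) = y"
      by simp
    then show ?thesis
      using linear_0[OF has_derivative_linear[OF 2]] that(2) by force
  qed
  have smb: "smooth_on (slit V) (\<lambda>p. g (fst p))" if "smooth_on V g" for g :: "real ^ 'n \<Rightarrow> real ^ 'n"
    by (rule smooth_on_compose[OF O V(1) _ that smooth_on_fst[OF O smooth_on_ident]]) (auto simp: slit_def)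
  have "smooth_on (slit V) (\<lambda>p. (\<psi> (fst p), \<Sum>b\<in>Basis. (snd p \<bullet> b) *\<^sub>R dir_deriv b \<psi> (fst p)))"
    by (intro smooth_on_Pair smb sm O smooth_on_sum smooth_on_bilinear[OF bounded_bilinear_scaleR]
        smooth_on_inner smooth_on_snd smooth_on_ident smooth_on_const smooth_on_dir_deriv)
  then have "smooth_on (slit V) (\<lambda>p. (\<psi> (fst p), frechet_derivative \<psi> (at (fst p)) (snd p)))"
  proof (rule smooth_on_cong[OF O, rotated])
    fix p assume "p \<in> slit V"
    then have "linear (frechet_derivative \<psi> (at (fst p)))"
      using smooth_on_differentiable[OF sm, of "fst p"] by (auto simp: slit_def intro: linear_frechet_derivative)
    then interpret linear "frechet_derivative \<psi> (at (fst p))" .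
    have "frechet_derivative \<psi> (at (fst p)) (snd p) =
        frechet_derivative \<psi> (at (fst p)) (\<Sum>b\<in>Basis. (snd p \<bullet> b) *\<^sub>R b)"
      by (simp add: euclidean_representation)
    then show "(\<psi> (fst p), \<Sum>b\<in>Basis. (snd p \<bullet> b) *\<^sub>R dir_deriv b \<psi> (fst p)) =
        (\<psi> (fst p), frechet_derivative \<psi> (at (fst p)) (snd p))"
      by (simp add: sum scale)
  qed
  from smooth_on_compose[OF O open_slit[OF assms(2)] _ assms(3) this] show ?thesis
    using V(3) inj by (force simp: in_coords_def case_prod_beta' slit_def)
qed

lemma homogeneous_in_coords:
  fixes F :: "('n::finite) tangent \<Rightarrow> real"
  assumes "local_coords U V \<psi>" "\<And>x y l. x \<in> U \<Longrightarrow> l > 0 \<Longrightarrow> F (x, l *\<^sub>R y) = l * F (x, y)"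
  shows "homogeneous_on V 1 (in_coords \<psi> F)"
  unfolding homogeneous_on_def
proof (intro ballI allI impI)
  fix x y :: "real ^ 'n" and l :: real
  assume *: "x \<in> V" "y \<noteq> 0" "l > 0"
  from * assms(1) have "\<psi> differentiable at x" and "\<psi> x \<in> U"
    by (auto simp: local_coords_def intro: smooth_on_differentiable)
  then show "in_coords \<psi> F (x, l *\<^sub>R y) = l ^ 1 * in_coords \<psi> F (x, y)"
    using linear_cmul[OF linear_frechet_derivative[OF \<open>\<psi> differentiable at x\<close>], of l y] assms(2) *
    by (simp add: in_coords_def)
qed

text \<open>
  In any adapted coordinates the spray is the raised vertical gradient of the cubic potential of the
  transformed metric. The factor \<open>-1/2\<close> in the definition of dual flatness therefore makes \<open>K\<close> minus
  twice that potential.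
\<close>

lemma adapted_ident_imp_dually_flat:
  fixes F :: "('n::finite) tangent \<Rightarrow> real"
  assumes "open U" "finsler_metric U F" "adapted U F U (\<lambda>x. x)"
  shows "dually_flat U F"
  unfolding dually_flat_def
proof (intro conjI allI impI)
  show "locally_dually_flat U F"
    unfolding locally_dually_flat_def using assms(3) by blast
  fix V \<psi> assume ad: "adapted U F V \<psi>"
  then have lc: "local_coords U V \<psi>" and df: "dual_flat_eqs V (in_coords \<psi> F)"
    by (simp_all add: adapted_def)
  then have V: "open V" by (simp add: local_coords_def)
  have sm: "smooth_on (slit V) (in_coords \<psi> F)"
    using lc assms(1) finsler_smooth[OF assms(2)] by (rule smooth_on_in_coords)
  have hom: "homogeneous_on V 1 (in_coords \<psi> F)"
    using lc by (rule homogeneous_in_coords) (use assms(2) in \<open>simp add: finsler_metric_def\<close>)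
  let ?K = "\<lambda>p. - 2 * cubic_potential (in_coords \<psi> F) p"
  note smP = smooth_on_cubic_potential[OF V sm]
  show "\<exists>K. smooth_on (slit V) K \<and>
             (\<forall>(x, y)\<in>slit V. \<forall>l>0. K (x, l *\<^sub>R y) = l ^ 3 * K (x, y)) \<and>
             (\<forall>p\<in>slit V. \<forall>i. spray (in_coords \<psi> F) i p =
                - 1/2 * (\<Sum>j\<in>UNIV. matrix_inv (fund_tensor (in_coords \<psi> F) p) $ i $ j * dy j K p))"
  proof (intro exI[of _ ?K] conjI ballI allI)
    show "smooth_on (slit V) ?K"
      using V smP by (intro smooth_on_mult smooth_on_const open_slit)
    show "case q of (x, y) \<Rightarrow> \<forall>l>0. ?K (x, l *\<^sub>R y) = l ^ 3 * ?K (x, y)" if "q \<in> slit V" for q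
      using homogeneous_onD[OF homogeneous_cubic_potential[OF V sm hom]] that by (auto simp: slit_def)
    fix p i assume p: "p \<in> slit V"
    show "spray (in_coords \<psi> F) i p =
        - 1/2 * (\<Sum>j\<in>UNIV. matrix_inv (fund_tensor (in_coords \<psi> F) p) $ i $ j * dy j ?K p)"
      unfolding spray_dual_flat[OF V sm df p] dy_cmult[OF smooth_on_differentiable[OF smP p]]
      by (simp add: sum_distrib_left)
  qed
qed

section \<open>The Funk metric\<close>

text \<open>
  If the horizontal gradient of \<open>f\<close> is the vertical gradient of \<open>g\<close>, the index of differentiation
  and the contracted index may be exchanged, and Euler's identity evaluates the contraction.
\<close>

lemma sum_dy_dx_of_dx_eq_dy:
  fixes f g :: "('n::finite) tangent \<Rightarrow> real"
  assumes "open U" "smooth_on (slit U) g" "homogeneous_on U (Suc m) g"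
    and "\<And>q k. q \<in> slit U \<Longrightarrow> dx k f q = dy k g q" and p: "p \<in> slit U"
  shows "(\<Sum>k\<in>UNIV. snd p $ k * dy i (dx k f) p) = m * dx i f p"
proof -
  note O = open_slit[OF assms(1)]
  have "dy i (dx k f) p = dy k (dy i g) p" for k
    by (rule trans[OF dy_cong[OF O p assms(4)] dy_commute[OF O p assms(2)]])
  then show ?thesis
    using euler_homogeneous[OF smooth_on_dy[OF assms(2)] homogeneous_dy[OF assms(1-3)] p] assms(4)[OF p]
    by simp
qed

lemma dir_deriv_power:
  fixes F :: "'a::real_normed_vector \<Rightarrow> real"
  assumes "F differentiable at p"
  shows "dir_deriv v (\<lambda>q. F q ^ n) p = n * F p ^ (n - 1) * dir_deriv v F p"
  using dir_deriv_eq[OF has_derivative_power[OF differentiable_has_dir_deriv[OF assms], of n]]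
  by (simp add: algebra_simps)

text \<open>
  The equation \<open>\<partial>\<^sub>k F = F \<partial>F/\<partial>y\<^sup>k\<close> says that the horizontal gradients of \<open>F\<close> and \<open>F\<^sup>2\<close> are the
  vertical gradients of \<open>F\<^sup>2/2\<close> and \<open>2F\<^sup>3/3\<close>, whose degrees 2 and 3 produce the coefficients 1 and 2
  of the two flatness equations.
\<close>

lemma flat_if_dx_eq_self_times_dy:
  fixes F :: "('n::finite) tangent \<Rightarrow> real"
  assumes U: "open U" and sm: "smooth_on (slit U) F" and hom: "homogeneous_on U 1 F"
    and eq: "\<And>q k. q \<in> slit U \<Longrightarrow> dx k F q = F q * dy k F q"
  shows "projectively_flat U F" "dual_flat_eqs U F"
proof -
  note O = open_slit[OF U]
  have diff: "F differentiable at q" if "q \<in> slit U" for q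
    using sm that by (rule smooth_on_differentiable)
  have pw: "smooth_on (slit U) (\<lambda>q. F q ^ n)" for n
    by (induction n) (auto intro: smooth_on_const smooth_on_mult O sm)
  have "(\<Sum>k\<in>UNIV. snd p $ k * dy i (dx k F) p) = real 1 * dx i F p" if p: "p \<in> slit U" for p i
  proof (rule sum_dy_dx_of_dx_eq_dy[OF U _ _ _ p])
    show "smooth_on (slit U) (\<lambda>q. 1/2 * F q ^ 2)"
      by (intro smooth_on_mult smooth_on_const O pw)
    show "homogeneous_on U (Suc 1) (\<lambda>q. 1/2 * F q ^ 2)"
      using hom by (auto simp: homogeneous_on_def power_mult_distrib numeral_2_eq_2)
    show "dx k F q = dy k (\<lambda>q. 1/2 * F q ^ 2) q" if q: "q \<in> slit U" for k q
      unfolding dy_cmult[OF smooth_on_differentiable[OF pw q]] eq[OF q]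
      by (simp add: dy_def dir_deriv_power[OF diff[OF q]])
  qed
  then show "projectively_flat U F"
    by (simp add: projectively_flat_def)
  have "(\<Sum>k\<in>UNIV. snd p $ k * dy i (dx k (sq F)) p) = real 2 * dx i (sq F) p" if p: "p \<in> slit U" for p i
  proof (rule sum_dy_dx_of_dx_eq_dy[OF U _ _ _ p])
    show "smooth_on (slit U) (\<lambda>q. 2/3 * F q ^ 3)"
      by (intro smooth_on_mult smooth_on_const O pw)
    show "homogeneous_on U (Suc 2) (\<lambda>q. 2/3 * F q ^ 3)"
      using hom by (auto simp: homogeneous_on_def power_mult_distrib numeral_3_eq_3 numeral_2_eq_2)
    show "dx k (sq F) q = dy k (\<lambda>q. 2/3 * F q ^ 3) q" if q: "q \<in> slit U" for k q
    proof -
      have "dx k (sq F) q = 2 * F q * dx k F q"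
        by (simp add: dx_def dir_deriv_power[OF diff[OF q]])
      also have "\<dots> = 2 * (F q)\<^sup>2 * dy k F q"
        by (simp add: eq[OF q] power2_eq_square)
      also have "\<dots> = dy k (\<lambda>q. 2/3 * F q ^ 3) q"
        unfolding dy_cmult[OF smooth_on_differentiable[OF pw q]]
        by (simp add: dy_def dir_deriv_power[OF diff[OF q]])
      finally show ?thesis .
    qed
  qed
  then show "dual_flat_eqs U F"
    by (simp add: dual_flat_eqs_def)
qed

lemma fund_tensor_quadratic_form:
  fixes F :: "('n::finite) tangent \<Rightarrow> real"
  assumes "open S" "smooth_on S F" "p \<in> S"
  shows "u \<bullet> (fund_tensor F p *v u) = 1/2 * dir_deriv (0, u) (dir_deriv (0, u) (sq F)) p"
proof -
  have sm: "smooth_on S (sq F)"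
    using assms(1,2) by (rule smooth_on_square)
  have diff: "dy j (sq F) differentiable at p" for j
    using smooth_on_dy[OF sm] assms(3) by (rule smooth_on_differentiable)
  have "frechet_derivative (dir_deriv (0, u) (sq F)) (at p) =
      frechet_derivative (\<lambda>q. \<Sum>j\<in>UNIV. u $ j * dy j (sq F) q) (at p)"
    by (rule dir_deriv_cong[OF assms(1,3) fibre_derivative[OF smooth_on_differentiable[OF sm]]])
  moreover have "((\<lambda>q. \<Sum>j\<in>UNIV. u $ j * dy j (sq F) q) has_derivative
      (\<lambda>v. \<Sum>j\<in>UNIV. u $ j * frechet_derivative (dy j (sq F)) (at p) v)) (at p)"
    by (intro has_derivative_sum has_derivative_mult_right differentiable_has_dir_deriv diff)
  ultimately have "dir_deriv (0, u) (dir_deriv (0, u) (sq F)) p =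
      (\<Sum>j\<in>UNIV. u $ j * dir_deriv (0, u) (dy j (sq F)) p)"
    using dir_deriv_eq by simp
  also have "\<dots> = (\<Sum>j\<in>UNIV. u $ j * (\<Sum>i\<in>UNIV. u $ i * dy i (dy j (sq F)) p))"
    using fibre_derivative[OF diff, where w = u] by simp
  also have "\<dots> = (\<Sum>i\<in>UNIV. \<Sum>j\<in>UNIV. u $ j * (u $ i * dy i (dy j (sq F)) p))"
    unfolding sum_distrib_left by (rule sum.swap)
  also have "\<dots> = 2 * (u \<bullet> (fund_tensor F p *v u))"
    by (simp add: inner_vec_def matrix_vector_mult_def fund_tensor_def sum_distrib_left algebra_simps)
  finally show ?thesis by simp
qed

lemma invertible_if_definite:
  fixes A :: "real ^ 'n ^ 'n"
  assumes "\<And>u. u \<noteq> 0 \<Longrightarrow> u \<bullet> (A *v u) \<noteq> 0"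
  shows "invertible A"
  unfolding invertible_left_inverse matrix_left_invertible_ker
  using assms by force

definition funk_root :: "real \<Rightarrow> ('n::finite) tangent \<Rightarrow> real" where
  "funk_root \<rho> p = sqrt ((\<rho>\<^sup>2 - fst p \<bullet> fst p) * (snd p \<bullet> snd p) + (fst p \<bullet> snd p)\<^sup>2)"

text \<open>
  The Funk metric of the ball of radius \<open>\<rho>\<close>: for \<open>y \<noteq> 0\<close> its value is the positive \<open>F\<close>
  for which \<open>x + y / F\<close> lies on the boundary sphere.
\<close>

definition funk :: "real \<Rightarrow> ('n::finite) tangent \<Rightarrow> real" where
  "funk \<rho> p = (funk_root \<rho> p + fst p \<bullet> snd p) / (\<rho>\<^sup>2 - fst p \<bullet> fst p)"

lemma funk_gap_pos: "x \<in> ball 0 \<rho> \<Longrightarrow> \<rho>\<^sup>2 - x \<bullet> x > 0"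
  using power_strict_mono[of "norm x" \<rho> 2] by (simp add: dot_square_norm)

lemma slit_ball_pos:
  assumes "p \<in> slit (ball 0 \<rho>)"
  shows "\<rho>\<^sup>2 - fst p \<bullet> fst p > 0" "snd p \<bullet> snd p > 0"
proof -
  have "fst p \<in> ball 0 \<rho>" "snd p \<noteq> 0"
    using assms by (auto simp: slit_def)
  then show "\<rho>\<^sup>2 - fst p \<bullet> fst p > 0" "snd p \<bullet> snd p > 0"
    using funk_gap_pos by auto
qed

lemma funk_radicand_pos:
  assumes "p \<in> slit (ball 0 \<rho>)"
  shows "(\<rho>\<^sup>2 - fst p \<bullet> fst p) * (snd p \<bullet> snd p) + (fst p \<bullet> snd p)\<^sup>2 > 0"
  using slit_ball_pos[OF assms] by (intro add_pos_nonneg mult_pos_pos) auto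

lemma funk_root_gt:
  assumes "p \<in> slit (ball 0 \<rho>)"
  shows "funk_root \<rho> p > \<bar>fst p \<bullet> snd p\<bar>"
  unfolding funk_root_def
proof (rule real_less_rsqrt)
  show "\<bar>fst p \<bullet> snd p\<bar>\<^sup>2 < (\<rho>\<^sup>2 - fst p \<bullet> fst p) * (snd p \<bullet> snd p) + (fst p \<bullet> snd p)\<^sup>2"
    using mult_pos_pos[OF slit_ball_pos[OF assms]] by simp
qed

lemma funk_root_eq:
  assumes "p \<in> slit (ball 0 \<rho>)"
  shows "funk_root \<rho> p = (\<rho>\<^sup>2 - fst p \<bullet> fst p) * funk \<rho> p - fst p \<bullet> snd p"
  using slit_ball_pos[OF assms] by (simp add: funk_def)

lemma funk_pos: "p \<in> slit (ball 0 \<rho>) \<Longrightarrow> funk \<rho> p > 0"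
  using funk_root_gt[of p \<rho>] slit_ball_pos(1)[of p \<rho>] by (simp add: funk_def abs_if split: if_splits)

text \<open>
  The equation \<open>|F x + y|\<^sup>2 = \<rho>\<^sup>2 F\<^sup>2\<close>. Derivatives of \<open>F\<close> are obtained by differentiating it
  implicitly, which avoids the square root.
\<close>

lemma funk_quadratic:
  assumes "p \<in> slit (ball 0 \<rho>)"
  shows "(\<rho>\<^sup>2 - fst p \<bullet> fst p) * (funk \<rho> p)\<^sup>2 - 2 * funk \<rho> p * (fst p \<bullet> snd p) - snd p \<bullet> snd p = 0"
proof -
  let ?A = "\<rho>\<^sup>2 - fst p \<bullet> fst p"
  have A: "?A > 0" using slit_ball_pos(1)[OF assms] .
  have "(?A * funk \<rho> p - fst p \<bullet> snd p)\<^sup>2 = ?A * (snd p \<bullet> snd p) + (fst p \<bullet> snd p)\<^sup>2"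
    unfolding funk_root_eq[OF assms, symmetric] funk_root_def
    using funk_radicand_pos[OF assms] by simp
  then have "?A * (?A * (funk \<rho> p)\<^sup>2 - 2 * funk \<rho> p * (fst p \<bullet> snd p) - snd p \<bullet> snd p) = 0"
    by (simp add: power2_eq_square algebra_simps)
  then show ?thesis using A by simp
qed

lemma smooth_on_funk_root: "smooth_on (slit (ball 0 \<rho>)) (funk_root \<rho>)"
  and smooth_on_funk: "smooth_on (slit (ball 0 \<rho>)) (funk \<rho>)"
proof -
  note O = open_slit[OF open_ball, of 0 \<rho>]
  note rules = smooth_on_mult smooth_on_inverse smooth_on_sqrt smooth_on_add smooth_on_diff
    smooth_on_inner smooth_on_const smooth_on_fst smooth_on_snd smooth_on_ident O
  show root: "smooth_on (slit (ball 0 \<rho>)) (funk_root \<rho>)"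
    unfolding funk_root_def[abs_def] power2_eq_square
    by (intro rules) (use funk_radicand_pos in \<open>simp add: power2_eq_square\<close>)
  show "smooth_on (slit (ball 0 \<rho>)) (funk \<rho>)"
    unfolding funk_def[abs_def] divide_inverse
    by (intro rules root) (use slit_ball_pos(1) in simp)
qed

lemma funk_dir_deriv:
  fixes p :: "('n::finite) tangent"
  assumes p: "p \<in> slit (ball 0 \<rho>)"
  shows "funk_root \<rho> p * dir_deriv v (funk \<rho>) p =
    (funk \<rho> p *\<^sub>R fst p + snd p) \<bullet> (funk \<rho> p *\<^sub>R fst v + snd v)"
proof -
  note O = open_slit[OF open_ball, of 0 \<rho>]
  let ?F = "funk \<rho> p" and ?D = "frechet_derivative (funk \<rho>) (at p)"
  define E where "E = (\<lambda>q :: 'n tangent. (\<rho>\<^sup>2 - fst q \<bullet> fst q) * (funk \<rho> q)\<^sup>2 -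
      2 * funk \<rho> q * (fst q \<bullet> snd q) - snd q \<bullet> snd q)"
  have D: "(funk \<rho> has_derivative ?D) (at p)"
    using smooth_on_differentiable[OF smooth_on_funk p] by (simp add: frechet_derivative_works)
  have dE: "(E has_derivative (\<lambda>v. - (fst p \<bullet> fst v + fst v \<bullet> fst p) * ?F\<^sup>2 + (\<rho>\<^sup>2 - fst p \<bullet> fst p) * (2 * ?F * ?D v)
      - (2 * ?D v * (fst p \<bullet> snd p) + 2 * ?F * (fst p \<bullet> snd v + fst v \<bullet> snd p))
      - (snd p \<bullet> snd v + snd v \<bullet> snd p))) (at p)"
    unfolding E_def by (auto intro!: derivative_eq_intros D simp: fun_eq_iff algebra_simps)
  have "(E has_derivative (\<lambda>v. 0)) (at p)"
    by (rule has_derivative_transform_within_open[OF has_derivative_const O p])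
       (simp add: E_def funk_quadratic)
  from fun_cong[OF has_derivative_unique[OF dE this], of v] show ?thesis
    unfolding funk_root_eq[OF p]
    by (simp add: inner_add_left inner_add_right inner_commute power2_eq_square algebra_simps)
qed

lemma funk_dx_eq: 
  assumes p: "p \<in> slit (ball 0 \<rho>)"
  shows "dx k (funk \<rho>) p = funk \<rho> p * dy k (funk \<rho>) p"
proof -
  have "funk_root \<rho> p * dx k (funk \<rho>) p = funk_root \<rho> p * (funk \<rho> p * dy k (funk \<rho>) p)"
    using funk_dir_deriv[OF p, of "(axis k 1, 0)"] funk_dir_deriv[OF p, of "(0, axis k 1)"]
    by (simp add: dx_def dy_def)
  moreover have "funk_root \<rho> p > 0" using funk_root_gt[OF p] by linarith
  ultimately show ?thesis by simp
qed

text \<open>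
  Differentiate the identity of \<open>funk_dir_deriv\<close> along the fibre once more, with the root replaced by its
  expression through \<open>F\<close> itself.
\<close>

lemma funk_second_deriv:
  fixes p :: "('n::finite) tangent" and u :: "real ^ 'n"
  assumes p: "p \<in> slit (ball 0 \<rho>)"
  defines "a \<equiv> dir_deriv (0, u) (funk \<rho>) p"
  shows "funk_root \<rho> p * dir_deriv (0, u) (dir_deriv (0, u) (funk \<rho>)) p =
    (u + a *\<^sub>R fst p) \<bullet> (u + a *\<^sub>R fst p) - \<rho>\<^sup>2 * a\<^sup>2"
proof -
  note O = open_slit[OF open_ball, of 0 \<rho>]
  let ?F = "funk \<rho>" and ?f = "dir_deriv (0, u) (funk \<rho>)"
  let ?D = "frechet_derivative ?F (at p)" and ?D2 = "frechet_derivative ?f (at p)"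
  define L where "L = (\<lambda>q. ((\<rho>\<^sup>2 - fst q \<bullet> fst q) * ?F q - fst q \<bullet> snd q) * ?f q)"
  define R where "R = (\<lambda>q. (?F q *\<^sub>R fst q + snd q) \<bullet> u)"
  have D: "(?F has_derivative ?D) (at p)"
    using smooth_on_differentiable[OF smooth_on_funk p] by (simp add: frechet_derivative_works)
  have D2: "(?f has_derivative ?D2) (at p)"
    using smooth_on_differentiable[OF smooth_on_dir_deriv[OF smooth_on_funk] p] by (simp add: frechet_derivative_works)
  have dL: "(L has_derivative (\<lambda>v. (- (fst p \<bullet> fst v + fst v \<bullet> fst p) * ?F p + (\<rho>\<^sup>2 - fst p \<bullet> fst p) * ?D v
        - (fst p \<bullet> snd v + fst v \<bullet> snd p)) * ?f p
      + ((\<rho>\<^sup>2 - fst p \<bullet> fst p) * ?F p - fst p \<bullet> snd p) * ?D2 v)) (at p)"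
    unfolding L_def by (auto intro!: derivative_eq_intros D D2 simp: fun_eq_iff algebra_simps)
  have dR: "(R has_derivative (\<lambda>v. (?D v *\<^sub>R fst p + ?F p *\<^sub>R fst v + snd v) \<bullet> u)) (at p)"
    unfolding R_def by (auto intro!: derivative_eq_intros D simp: fun_eq_iff algebra_simps)
  have "(R has_derivative (\<lambda>v. (- (fst p \<bullet> fst v + fst v \<bullet> fst p) * ?F p + (\<rho>\<^sup>2 - fst p \<bullet> fst p) * ?D v
        - (fst p \<bullet> snd v + fst v \<bullet> snd p)) * ?f p
      + ((\<rho>\<^sup>2 - fst p \<bullet> fst p) * ?F p - fst p \<bullet> snd p) * ?D2 v)) (at p)"
    by (rule has_derivative_transform_within_open[OF dL O p])
       (use funk_dir_deriv[of _ \<rho> "(0, u)"] in \<open>simp add: L_def R_def funk_root_eq\<close>)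
  from fun_cong[OF has_derivative_unique[OF dR this], of "(0, u)"] show ?thesis
    unfolding funk_root_eq[OF p] a_def
    by (simp add: inner_add_left inner_add_right inner_commute power2_eq_square algebra_simps)
qed

text \<open>
  The tensor is positive definite. With \<open>a\<close> and \<open>b\<close> the first and second derivatives of \<open>F\<close> along
  \<open>u\<close>, its value on \<open>u\<close> is \<open>a\<^sup>2 + F b\<close>. The vector \<open>m = F x + y\<close> has length \<open>\<rho> F\<close> and, for
  \<open>w = u + a x\<close>, inner product \<open>\<rho>\<^sup>2 F a\<close> with \<open>w\<close>; so the Cauchy-Schwarz inequality reads
  \<open>\<rho>\<^sup>2 a\<^sup>2 \<le> |w|\<^sup>2\<close>, which is \<open>b \<ge> 0\<close>. If \<open>a = 0\<close> then \<open>w = u\<close> and \<open>b > 0\<close>.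
\<close>

lemma funk_fund_tensor_invertible:
  fixes p :: "('n::finite) tangent"
  assumes p: "p \<in> slit (ball 0 \<rho>)"
  shows "invertible (fund_tensor (funk \<rho>) p)"
proof (rule invertible_if_definite)
  fix u :: "real ^ 'n" assume u: "u \<noteq> 0"
  note O = open_slit[OF open_ball, of 0 \<rho>]
  let ?F = "funk \<rho>" and ?f = "dir_deriv (0, u) (funk \<rho>)"
  define a where "a = ?f p"
  define b where "b = dir_deriv (0, u) ?f p"
  define w where "w = u + a *\<^sub>R fst p"
  define m where "m = ?F p *\<^sub>R fst p + snd p"
  have F: "?F p > 0" using p by (rule funk_pos)
  have Q: "funk_root \<rho> p > 0" using funk_root_gt[OF p] by linarith
  have \<rho>: "\<rho> > 0" using p by (auto simp: slit_def intro: le_less_trans[OF norm_ge_zero])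
  have diff: "?F differentiable at q" if "q \<in> slit (ball 0 \<rho>)" for q
    using smooth_on_funk that by (rule smooth_on_differentiable)
  have diff2: "?f differentiable at p"
    using smooth_on_dir_deriv[OF smooth_on_funk] p by (rule smooth_on_differentiable)
  have b: "funk_root \<rho> p * b = w \<bullet> w - \<rho>\<^sup>2 * a\<^sup>2"
    unfolding b_def w_def a_def by (rule funk_second_deriv[OF p])
  have "u \<bullet> (fund_tensor ?F p *v u) = 1/2 * dir_deriv (0, u) (dir_deriv (0, u) (sq ?F)) p"
    using O smooth_on_funk p by (rule fund_tensor_quadratic_form)
  also have "dir_deriv (0, u) (dir_deriv (0, u) (sq ?F)) p = dir_deriv (0, u) (\<lambda>q. 2 * ?F q * ?f q) p"
    by (rule fun_cong[OF dir_deriv_cong[OF O p]]) (simp add: dir_deriv_power[OF diff])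
  also have "\<dots> = 2 * (a\<^sup>2 + ?F p * b)"
    using dir_deriv_eq[OF has_derivative_mult[OF has_derivative_mult_right[OF
            differentiable_has_dir_deriv[OF diff[OF p]], of 2] differentiable_has_dir_deriv[OF diff2]], of "(0, u)"]
    by (simp add: a_def b_def power2_eq_square algebra_simps)
  finally have g: "u \<bullet> (fund_tensor ?F p *v u) = a\<^sup>2 + ?F p * b"
    by simp
  have mm: "m \<bullet> m = \<rho>\<^sup>2 * (?F p)\<^sup>2"
    using funk_quadratic[OF p]
    by (simp add: m_def inner_add_left inner_add_right inner_commute power2_eq_square algebra_simps)
  have "m \<bullet> u = funk_root \<rho> p * a"
    using funk_dir_deriv[OF p, of "(0, u)"] by (simp add: m_def a_def)
  then have mw: "m \<bullet> w = a * \<rho>\<^sup>2 * ?F p"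
    unfolding w_def inner_add_right funk_root_eq[OF p]
    by (simp add: m_def inner_add_left inner_commute power2_eq_square algebra_simps)
  have "(a * \<rho>\<^sup>2 * ?F p)\<^sup>2 \<le> (\<rho>\<^sup>2 * (?F p)\<^sup>2) * (w \<bullet> w)"
    using Cauchy_Schwarz_ineq[of m w] by (simp add: mm mw)
  then have "(\<rho>\<^sup>2 * (?F p)\<^sup>2) * (\<rho>\<^sup>2 * a\<^sup>2) \<le> (\<rho>\<^sup>2 * (?F p)\<^sup>2) * (w \<bullet> w)"
    by (simp add: power2_eq_square algebra_simps)
  then have "\<rho>\<^sup>2 * a\<^sup>2 \<le> w \<bullet> w"
    using F \<rho> by (simp add: mult_le_cancel_left_pos)
  then have "funk_root \<rho> p * b \<ge> 0" using b by simp
  then have b0: "b \<ge> 0" using Q by (simp add: zero_le_mult_iff)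
  have "a\<^sup>2 + ?F p * b > 0"
  proof (cases "a = 0")
    case True
    then have "funk_root \<rho> p * b > 0" using b u by (simp add: w_def)
    then have "b > 0" using Q by (simp add: zero_less_mult_iff)
    then show ?thesis using F by (simp add: add_nonneg_pos)
  next
    case False
    then show ?thesis using F b0 by (simp add: add_pos_nonneg)
  qed
  then show "u \<bullet> (fund_tensor ?F p *v u) \<noteq> 0" using g by simp
qed

lemma funk_scale: "l > 0 \<Longrightarrow> funk \<rho> (x, l *\<^sub>R y) = l * funk \<rho> (x, y)"
proof -
  assume l: "l > 0"
  have "(\<rho>\<^sup>2 - x \<bullet> x) * (l *\<^sub>R y \<bullet> l *\<^sub>R y) + (x \<bullet> l *\<^sub>R y)\<^sup>2 = l\<^sup>2 * ((\<rho>\<^sup>2 - x \<bullet> x) * (y \<bullet> y) + (x \<bullet> y)\<^sup>2)"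
    by (simp add: power2_eq_square algebra_simps)
  then have "funk_root \<rho> (x, l *\<^sub>R y) = l * funk_root \<rho> (x, y)"
    using l by (simp add: funk_root_def real_sqrt_mult)
  then show ?thesis by (simp add: funk_def algebra_simps)
qed

lemma finsler_metric_funk: "finsler_metric (ball 0 \<rho>) (funk \<rho>)"
  unfolding finsler_metric_def
proof (intro conjI ballI allI impI)
  fix x y :: "real ^ 'n" assume x: "x \<in> ball 0 \<rho>"
  have "funk \<rho> (x, 0) = 0" by (simp add: funk_def funk_root_def)
  moreover have "funk \<rho> (x, y) > 0" if "y \<noteq> 0"
    using that x by (intro funk_pos) (simp add: slit_def)
  ultimately show "0 \<le> funk \<rho> (x, y)" "funk \<rho> (x, y) = 0 \<longleftrightarrow> y = 0"
    by (cases "y = 0"; force)+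
qed (auto simp: smooth_on_funk funk_scale funk_fund_tensor_invertible)

text \<open>
  The profile depends on \<open>r\<close> through \<open>r\<^sup>2\<close> alone, so its formula is smooth for \<open>-\<rho> < r < \<rho>\<close>.
\<close>

lemma spherically_symmetric_funk: "spherically_symmetric \<rho> (funk \<rho>)"
  unfolding spherically_symmetric_def
proof (intro exI conjI)
  let ?\<phi> = "\<lambda>q. (sqrt (\<rho>\<^sup>2 - fst q * fst q + snd q * snd q) + snd q) * inverse (\<rho>\<^sup>2 - fst q * fst q)"
  let ?W = "{-\<rho><..<\<rho>} \<times> (UNIV :: real set)"
  show W: "open ?W" by (intro open_Times) auto
  show "{0..<\<rho>} \<times> UNIV \<subseteq> ?W" by auto
  have gap: "\<rho>\<^sup>2 - r * r > 0" if "r \<in> {-\<rho><..<\<rho>}" for r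
    using that power_strict_mono[of "\<bar>r\<bar>" \<rho> 2] by (auto simp: power2_eq_square abs_less_iff)
  show "smooth_on ?W ?\<phi>"
    by (intro smooth_on_mult smooth_on_inverse smooth_on_sqrt smooth_on_add smooth_on_diff
        smooth_on_const smooth_on_fst smooth_on_snd smooth_on_ident W)
       (use gap in \<open>auto intro: add_pos_nonneg\<close>)
  show "\<forall>x\<in>ball 0 \<rho>. \<forall>y. y \<noteq> 0 \<longrightarrow> funk \<rho> (x, y) = norm y * ?\<phi> (norm x, (x \<bullet> y) / norm y)"
  proof (intro ballI allI impI)
    fix x y :: "real ^ 'n" assume "y \<noteq> 0"
    define s where "s = (x \<bullet> y) / norm y"
    have s: "x \<bullet> y = norm y * s" using \<open>y \<noteq> 0\<close> by (simp add: s_def)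
    have "(\<rho>\<^sup>2 - x \<bullet> x) * (y \<bullet> y) + (x \<bullet> y)\<^sup>2 = (norm y)\<^sup>2 * (\<rho>\<^sup>2 - norm x * norm x + s * s)"
      unfolding s dot_square_norm by (simp add: power2_eq_square algebra_simps)
    then have "funk_root \<rho> (x, y) = norm y * sqrt (\<rho>\<^sup>2 - norm x * norm x + s * s)"
      by (simp add: funk_root_def real_sqrt_mult)
    then have "funk \<rho> (x, y) = norm y * ?\<phi> (norm x, s)"
      by (simp add: funk_def s divide_inverse dot_square_norm power2_eq_square algebra_simps)
    then show "funk \<rho> (x, y) = norm y * ?\<phi> (norm x, (x \<bullet> y) / norm y)"
      by (simp only: s_def)
  qed
qed

lemma flat_spherical_metric_funk: "flat_spherical_metric \<rho> (funk \<rho> :: ('n::finite) tangent \<Rightarrow> real)"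
proof -
  let ?B = "ball (0 :: real ^ 'n) \<rho>" and ?F = "funk \<rho> :: 'n tangent \<Rightarrow> real"
  have fm: "finsler_metric ?B ?F" by (rule finsler_metric_funk)
  note flat = flat_if_dx_eq_self_times_dy[OF open_ball smooth_on_funk finsler_homogeneous[OF fm] funk_dx_eq]
  have "smooth_on ?B (the_inv_into ?B (\<lambda>x. x))"
    by (rule smooth_on_cong[OF open_ball _ smooth_on_ident]) (simp add: the_inv_into_f_eq)
  then have ad: "adapted ?B ?F ?B (\<lambda>x. x)"
    using flat(2) by (simp add: adapted_def local_coords_def in_coords_def smooth_on_ident)
  show ?thesis
    unfolding flat_spherical_metric_def
    using fm spherically_symmetric_funk flat(1) adapted_ident_imp_dually_flat[OF open_ball fm ad] ad by blast
qed

text \<open>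
  Unlike a norm, the metric distinguishes \<open>y\<close> from \<open>-y\<close> unless \<open>y\<close> is orthogonal to \<open>x\<close>.
\<close>

lemma not_scaled_euclidean_funk:
  assumes "\<rho> > 0"
  shows "\<not> scaled_euclidean \<rho> (funk \<rho> :: ('n::finite) tangent \<Rightarrow> real)"
proof
  assume "scaled_euclidean \<rho> (funk \<rho> :: 'n tangent \<Rightarrow> real)"
  then obtain a where a: "\<And>x y :: real ^ 'n. x \<in> ball 0 \<rho> \<Longrightarrow> funk \<rho> (x, y) = a * norm y"
    unfolding scaled_euclidean_def by blast
  define x :: "real ^ 'n" where "x = (\<rho> / 2) *\<^sub>R axis undefined 1"
  have x: "x \<in> ball 0 \<rho>" "x \<noteq> 0"
    using assms by (simp_all add: x_def norm_axis_1)
  have "funk \<rho> (x, x) = funk \<rho> (x, - x)"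
    using a[OF x(1), of x] a[OF x(1), of "- x"] by simp
  then show False
    using x funk_gap_pos[OF x(1)] by (simp add: funk_def funk_root_def)
qed

theorem theorem4p8:
  fixes r0 :: real
  assumes "r0 > 0"
  shows "(\<forall>F :: ('n::finite) tangent \<Rightarrow> real.
            flat_spherical_metric r0 F \<longrightarrow> H_Landsberg (ball 0 r0) F) \<and>
         (CARD('n) \<ge> 2 \<longrightarrow>
            (\<forall>F :: 'n tangent \<Rightarrow> real.
               flat_spherical_metric r0 F \<and> \<not> scaled_euclidean r0 F \<longrightarrow> \<not> H_Berwald (ball 0 r0) F) \<and>
            (\<exists>F :: 'n tangent \<Rightarrow> real.
               flat_spherical_metric r0 F \<and> H_unicorn (ball 0 r0) F))"
proof -
  have Landsberg: "H_Landsberg (ball 0 r0) F" if "flat_spherical_metric r0 F" for F :: "'n tangent \<Rightarrow> real"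
    using that dual_flat_imp_H_Landsberg[OF open_ball] adapted_ident_imp_dual_flat
    unfolding flat_spherical_metric_def by blast
  have not_Berwald: "\<not> H_Berwald (ball 0 r0) F"
    if "CARD('n) \<ge> 2" "flat_spherical_metric r0 F" "\<not> scaled_euclidean r0 F" for F :: "'n tangent \<Rightarrow> real"
    using that flat_spherical_H_Berwald_imp_scaled_euclidean[OF that(1) assms] adapted_ident_imp_dual_flat
    unfolding flat_spherical_metric_def by blast
  show ?thesis
    using Landsberg not_Berwald flat_spherical_metric_funk not_scaled_euclidean_funk[OF assms]
    unfolding H_unicorn_def by blast
qed

end
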